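(* Assume that $\overline{A_j}>0$ for all $j\in\{1,\dots,L-1\}$, where $$\overline{A_j}:=\frac{\mu_jN_je^{-\mu_j\tau_j}-(1-e^{-\mu_j\tau_j})\,C^{no}_{j+1}}{\mu_j}.$$ Then there exists a unique stationary state of the system $$\partial_t\rho_L+\partial_s\rho_L+\mu_L\rho_L=0,\qquad \rho_L(t,s=0)=\mu_LN_L,$$ $$\partial_t\rho_j+\partial_s\rho_j+\mu_j\rho_j+\frac{C^{no}_{j+1}}{A_j(t)}\,\mathbb{I}_{s\ge\tau_j}\,\rho_j=0,\qquad \rho_j(t,s=0)=\sum_{l=j}^{L}\mu_lN_l,\qquad 1\le j\le L-1,$$ and it is given by $$\overline{\rho_L}(s)=\mu_LN_Le^{-\mu_Ls},\qquad \overline{\rho_j}(s)=e^{-\mu_js+B_j(\tau_j-s)_-}\left(\sum_{l=j}^{L}\mu_lN_l\right)\quad(1\le j\le L-1),\qquad B_j:=\frac{\sum_{l=j+1}^{L}\mu_lN_l}{\overline{A_j}} .$$ Moreover, for initial data $\rho_j^0\in L^1(\mathbb{R}^+)$, $1\le j\le L$, such that for $1\le j\le L-1$ and all $t\in[0,\tau_j]$ $$e^{-t\mu_j}\int_t^{\tau_j}\rho_j^0(s-t)\,ds+\frac{1}{\mu_j}\left(1-e^{-\mu_jt}\right)\sum_{l=j}^{L}\mu_lN_l<N_j,$$ there is a constant $C$ such that for all $j\in\{1,\dots,L\}$ and all $t\ge\max_j\tau_j$, the solution with $\rho_j(0,\cdot)=\rho_j^0$ satisfies $$\int_0^{+\infty}|\rho_j(t,s)-\overline{\rho_j}(s)|\,ds\le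 C\,e^{-\mu_jt}\int_0^{+\infty}|\rho_j(0,s)-\overline{\rho_j}(s)|\,ds .$$
   Context: $L\ge2$ is an integer (number of hierarchical job levels). For $1\le j\le L$, the parameters $N_j>0$ (size of job class $j$), $\mu_j>0$ (turnover rate) and $\tau_j\ge0$ (minimal waiting time before promotion) are given constants. $\rho_j(t,s)$, $t\ge0$, $s\ge0$, is the density of workers in job $j$ at time $t$ with seniority $s$. Notation: $\mathbb{I}$ is the indicator function, $(x)_-=\min(x,0)$, $$A_j(t)=\int_{\tau_j}^{+\infty}\rho_j(t,s)\,ds,\qquad C^{no}_j:=\sum_{l=j}^{L}\mu_lN_l .$$ Standing assumptions on the initial data: $\rho_j^0(s)>0$ and $\int_0^{+\infty}\rho_j^0(s)\,ds=N_j$. Solutions are weak solutions in $C([0,\infty);L^1(\mathbb{R}^+))$ (integration along characteristics) with $A_j(t)>0$ for $1\le j\le L-1$. A stationary state is a time-independent nonnegative integrable solution of the system (with $A_j>0$ for $1\le j\le L-1$). *)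

theory Defs
  imports "HOL-Analysis.Analysis"
begin

text \<open>
  Job levels are indexed by \<open>j \<in> {1..L}\<close>; a family of densities is a function
  \<open>\<rho> j t s\<close> (level, time, seniority), and only \<open>t \<ge> 0\<close>, \<open>s \<ge> 0\<close> matter. Elements of
  \<open>L\<^sup>1\<close> of the half line are represented by Borel functions, integrable on \<open>{0..}\<close> and
  identified when they agree almost everywhere there.
\<close>

definition Cno :: "nat \<Rightarrow> (nat \<Rightarrow> real) \<Rightarrow> (nat \<Rightarrow> real) \<Rightarrow> nat \<Rightarrow> real" where
  "Cno L N \<mu> j = (\<Sum>l=j..L. \<mu> l * N l)"

definition promotable :: "(nat \<Rightarrow> real) \<Rightarrow> nat \<Rightarrow> (real \<Rightarrow> real) \<Rightarrow> real" where
  "promotable \<tau> j f = (LINT s:{\<tau> j..}|lborel. f s)"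

text \<open>
  Coefficient of the zeroth order term of the equation for \<open>\<rho>\<^sub>j\<close>; \<open>f\<close> is the density
  \<open>\<rho>\<^sub>j(t, \<cdot>)\<close>, on which the coefficient depends through \<open>A\<^sub>j(t)\<close>.
\<close>

definition loss_rate ::
  "nat \<Rightarrow> (nat \<Rightarrow> real) \<Rightarrow> (nat \<Rightarrow> real) \<Rightarrow> (nat \<Rightarrow> real) \<Rightarrow> nat \<Rightarrow> (real \<Rightarrow> real) \<Rightarrow> real \<Rightarrow> real" where
  "loss_rate L N \<mu> \<tau> j f s =
     (if j < L then \<mu> j + Cno L N \<mu> (j + 1) / promotable \<tau> j f * indicator {\<tau> j..} s
      else \<mu> j)"

definition continuous_in_L1 :: "(real \<Rightarrow> real \<Rightarrow> real) \<Rightarrow> bool" where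
  "continuous_in_L1 u \<longleftrightarrow>
     (\<forall>t\<ge>0. set_integrable lborel {0..} (u t)) \<and>
     (\<forall>t\<ge>0. ((\<lambda>t'. LINT s:{0..}|lborel. \<bar>u t' s - u t s\<bar>) \<longlongrightarrow> 0) (at t within {0..}))"

text \<open>
  Weak solutions in the sense of integration along characteristics. The characteristic through
  \<open>(t, s)\<close> is \<open>r \<mapsto> (r, s - t + r)\<close>; going backwards it leaves the quadrant at time
  \<open>max 0 (t - s)\<close>, either through the initial line (\<open>s \<ge> t\<close>), where the value is that of
  \<open>\<rho> j 0\<close>, or through the boundary \<open>s = 0\<close>, where the value is prescribed. For \<open>j = L\<close> the
  boundary value \<open>Cno L N \<mu> L\<close> is \<open>\<mu>\<^sub>L N\<^sub>L\<close>.

  Joint measurability selects a representative for which the integrals along characteristics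
  are meaningful; every element of \<open>C([0,\<infinity>); L\<^sup>1)\<close> has such a representative, and by Fubini
  the equation does not depend on the choice. The integrability clause is explicit because
  the Bochner integral is 0 on nonintegrable functions.
\<close>

definition is_solution ::
  "nat \<Rightarrow> (nat \<Rightarrow> real) \<Rightarrow> (nat \<Rightarrow> real) \<Rightarrow> (nat \<Rightarrow> real) \<Rightarrow> (nat \<Rightarrow> real \<Rightarrow> real \<Rightarrow> real) \<Rightarrow> bool" where
  "is_solution L N \<mu> \<tau> \<rho> \<longleftrightarrow>
     (\<forall>j\<in>{1..L}.
        set_borel_measurable borel ({0..} \<times> {0..}) (\<lambda>(t, s). \<rho> j t s) \<and>
        continuous_in_L1 (\<rho> j) \<and>
        (j < L \<longrightarrow> (\<forall>t\<ge>0. promotable \<tau> j (\<rho> j t) > 0)) \<and>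
        (\<forall>t\<ge>0. AE s in lborel. s \<ge> 0 \<longrightarrow>
           set_integrable lborel {max 0 (t - s)..t}
             (\<lambda>r. loss_rate L N \<mu> \<tau> j (\<rho> j r) (s - t + r) * \<rho> j r (s - t + r)) \<and>
           \<rho> j t s = (if s \<ge> t then \<rho> j 0 (s - t) else Cno L N \<mu> j)
             - (LINT r:{max 0 (t - s)..t}|lborel.
                  loss_rate L N \<mu> \<tau> j (\<rho> j r) (s - t + r) * \<rho> j r (s - t + r))))"

definition solves_ivp ::
  "nat \<Rightarrow> (nat \<Rightarrow> real) \<Rightarrow> (nat \<Rightarrow> real) \<Rightarrow> (nat \<Rightarrow> real) \<Rightarrow> (nat \<Rightarrow> real \<Rightarrow> real)
     \<Rightarrow> (nat \<Rightarrow> real \<Rightarrow> real \<Rightarrow> real) \<Rightarrow> bool" where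
  "solves_ivp L N \<mu> \<tau> \<rho>0 \<rho> \<longleftrightarrow>
     is_solution L N \<mu> \<tau> \<rho> \<and>
     (\<forall>j\<in>{1..L}. AE s in lborel. s \<ge> 0 \<longrightarrow> \<rho> j 0 s = \<rho>0 j s)"

definition stationary_state ::
  "nat \<Rightarrow> (nat \<Rightarrow> real) \<Rightarrow> (nat \<Rightarrow> real) \<Rightarrow> (nat \<Rightarrow> real) \<Rightarrow> (nat \<Rightarrow> real \<Rightarrow> real) \<Rightarrow> bool" where
  "stationary_state L N \<mu> \<tau> r \<longleftrightarrow>
     is_solution L N \<mu> \<tau> (\<lambda>j t. r j) \<and>
     (\<forall>j\<in>{1..L}. AE s in lborel. s \<ge> 0 \<longrightarrow> r j s \<ge> 0)"

definition A_bar ::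
  "nat \<Rightarrow> (nat \<Rightarrow> real) \<Rightarrow> (nat \<Rightarrow> real) \<Rightarrow> (nat \<Rightarrow> real) \<Rightarrow> nat \<Rightarrow> real" where
  "A_bar L N \<mu> \<tau> j =
     (\<mu> j * N j * exp (- \<mu> j * \<tau> j) - (1 - exp (- \<mu> j * \<tau> j)) * Cno L N \<mu> (j + 1)) / \<mu> j"

definition B_bar ::
  "nat \<Rightarrow> (nat \<Rightarrow> real) \<Rightarrow> (nat \<Rightarrow> real) \<Rightarrow> (nat \<Rightarrow> real) \<Rightarrow> nat \<Rightarrow> real" where
  "B_bar L N \<mu> \<tau> j = (\<Sum>l=j+1..L. \<mu> l * N l) / A_bar L N \<mu> \<tau> j"

definition rho_bar ::
  "nat \<Rightarrow> (nat \<Rightarrow> real) \<Rightarrow> (nat \<Rightarrow> real) \<Rightarrow> (nat \<Rightarrow> real) \<Rightarrow> nat \<Rightarrow> real \<Rightarrow> real" where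
  "rho_bar L N \<mu> \<tau> j s =
     (if j < L
      then exp (- \<mu> j * s + B_bar L N \<mu> \<tau> j * min (\<tau> j - s) 0) * (\<Sum>l=j..L. \<mu> l * N l)
      else \<mu> L * N L * exp (- \<mu> L * s))"

end

theory Submission
  imports Defs
begin

text \<open>
  The levels decouple, and level \<open>L\<close> is the case of promotion flux \<open>c = 0\<close>. On one level, for a
  given coefficient \<open>q(t) = c / A(t)\<close>, the linear transport problem has an explicit solution, unique
  by a Gronwall argument in \<open>L\<^sup>1\<close>. The total flux out of the level by promotion is
  \<open>q(t) A(t) = c\<close>, so the mass \<open>M\<close> satisfies \<open>M' = \<mu> (N - M)\<close> and stays equal to \<open>N\<close>. Since \<open>q\<close> does
  not act on seniorities below \<open>\<tau>\<close>, the mass there is known in advance and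
  \<open>A\<close> is its complement in \<open>N\<close>: the nonlinear problem reduces to the linear one with a known
  coefficient, which is constant from time \<open>\<tau>\<close> on. Workers hired after time \<open>0\<close> become promotable
  only after \<open>\<tau>\<close>, hence the solution coincides with the stationary state for
  \<open>s < t\<close>, while for \<open>s \<ge> t\<close> both are damped by at least \<open>exp (- \<mu> t)\<close>.
\<close>

text \<open>The rate needs \<open>A\<close>, and \<open>A\<close> is \<open>N\<close> minus the
  young mass only after the total mass is known to be \<open>N\<close>. For a given solution the
  mass comes first. For existence the rate is written down with \<open>N\<close> in place of the
  unknown mass, and the defect between the two satisfies a linear homogeneous equation with zero
  initial value.

  The smallness hypothesis on the data says exactly that the young mass stays below \<open>N\<close>
  on \<open>{0..\<tau> j}\<close>; after that time the young mass is constant and its distance to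
  \<open>N\<close> is \<open>A_bar\<close>. The two hypotheses together therefore keep every
  denominator positive.

  Up to time \<tau> the rate of the solution and the stationary rate may differ, so for
  \<open>s \<ge> t\<close> the two densities carry different damping factors. They are estimated
  separately, not through their difference. The resulting bound contains the sum of the two initial
  L1 norms, and the constant of the theorem is this sum divided by the initial L1 distance.\<close>

section \<open>Gronwall's inequality in integral form\<close>

text \<open>With the integrating factor \<open>exp (- K * t)\<close> the primitive of
  \<open>f\<close> becomes nonincreasing, and it starts at 0. The integral form suits L1 norms of
  solutions, which are known to be continuous but not differentiable.\<close>

lemma gronwall_zero:
  fixes f :: "real \<Rightarrow> real"
  assumes cont: "continuous_on {0..T} f"
    and nonneg: "\<And>t. t \<in> {0..T} \<Longrightarrow> f t \<ge> 0"
    and K: "K \<ge> 0"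
    and le: "\<And>t. t \<in> {0..T} \<Longrightarrow> f t \<le> K * integral {0..t} f"
    and t: "t \<in> {0..T}"
  shows "f t = 0"
proof -
  define F where "F = (\<lambda>t. integral {0..t} f)"
  define G where "G = (\<lambda>t. exp (- K * t) * F t)"
  have dF: "(F has_real_derivative f x) (at x within {0..T})" if "x \<in> {0..T}" for x
    unfolding F_def using integral_has_real_derivative[OF cont that] .
  have dG: "(G has_real_derivative exp (- K * x) * (f x - K * F x)) (at x within {0..T})"
    if "x \<in> {0..T}" for x
    unfolding G_def by (rule derivative_eq_intros dF[OF that] refl | simp add: algebra_simps)+
  have "G t \<le> G 0"
  proof (cases "t = 0")
    case False
    show ?thesis
    proof (rule DERIV_nonpos_imp_decreasing_open[of 0 t G])
      show "0 \<le> t" using t by auto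
      show "continuous_on {0..t} G"
        using t by (intro continuous_on_subset[OF DERIV_continuous_on[OF dG]]) auto
    next
      fix x assume x: "0 < x" "x < t"
      then have "f x - K * F x \<le> 0" using le[of x] t by (auto simp: F_def)
      then have "exp (- K * x) * (f x - K * F x) \<le> 0" by (simp add: mult_le_0_iff)
      moreover have "(G has_real_derivative exp (- K * x) * (f x - K * F x)) (at x)"
        using dG[of x] x t by (simp add: at_within_Icc_at)
      ultimately show "\<exists>y. (G has_real_derivative y) (at x) \<and> y \<le> 0" by blast
    qed
  qed simp
  then have "F t \<le> 0" by (simp add: G_def F_def mult_le_0_iff not_less)
  moreover have "f t \<le> K * F t" using le[OF t] by (simp add: F_def)
  ultimately have "f t \<le> 0" using K mult_nonneg_nonpos[of K "F t"] by linarith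
  then show ?thesis using nonneg[OF t] by simp
qed

subsection \<open>Continuity of translations in \<open>L\<^sup>1\<close>\<close>

text \<open>Translation is an isometry of L1, so a three-epsilon argument carries the property to
  limits. It serves twice below: from open sets to measurable sets, and from approximating functions
  to their limit.\<close>

lemma translation_L1_approx:
  fixes f :: "real \<Rightarrow> real"
  assumes f: "integrable lborel f"
    and approx: "\<And>e. e > 0 \<Longrightarrow> \<exists>g. integrable lborel g \<and> (LINT s|lborel. \<bar>f s - g s\<bar>) < e \<and>
        (\<lambda>n. LINT s|lborel. \<bar>g (s - h n) - g s\<bar>) \<longlonglongrightarrow> 0"
  shows "(\<lambda>n. LINT s|lborel. \<bar>f (s - h n) - f s\<bar>) \<longlonglongrightarrow> 0"
proof (rule LIMSEQ_I)
  fix e :: real assume "e > 0"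
  then obtain g where g: "integrable lborel g" "(LINT s|lborel. \<bar>f s - g s\<bar>) < e / 3"
    and lim: "(\<lambda>n. LINT s|lborel. \<bar>g (s - h n) - g s\<bar>) \<longlonglongrightarrow> 0"
    using approx[of "e / 3"] by auto
  have tr: "integrable lborel (\<lambda>s. k (s - a))" "(LINT s|lborel. k (s - a)) = (LINT s|lborel. k s)"
    if "integrable lborel k" for a and k :: "real \<Rightarrow> real"
    using lborel_integrable_real_affine[OF that, of 1 "-a"]
      lborel_integral_real_affine[of 1 k "-a"] by (simp_all)
  obtain n0 where n0: "\<And>n. n \<ge> n0 \<Longrightarrow> \<bar>LINT s|lborel. \<bar>g (s - h n) - g s\<bar>\<bar> < e / 3"
    using LIMSEQ_D[OF lim, of "e / 3"] \<open>e > 0\<close> by auto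
  have "norm ((LINT s|lborel. \<bar>f (s - h n) - f s\<bar>) - 0) < e" if "n \<ge> n0" for n
  proof -
    have fg: "integrable lborel (\<lambda>s. \<bar>f s - g s\<bar>)" using f g by simp
    have "(LINT s|lborel. \<bar>f (s - h n) - f s\<bar>)
      \<le> (LINT s|lborel. \<bar>f (s - h n) - g (s - h n)\<bar> + \<bar>g (s - h n) - g s\<bar> + \<bar>f s - g s\<bar>)"
      using f g tr(1)[of f "h n"] tr(1)[of g "h n"] by (intro integral_mono) auto
    also have "\<dots> = (LINT s|lborel. \<bar>f (s - h n) - g (s - h n)\<bar>)
        + (LINT s|lborel. \<bar>g (s - h n) - g s\<bar>) + (LINT s|lborel. \<bar>f s - g s\<bar>)"
      using f g tr(1)[of f "h n"] tr(1)[of g "h n"] by (subst Bochner_Integration.integral_add) auto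
    also have "(LINT s|lborel. \<bar>f (s - h n) - g (s - h n)\<bar>) = (LINT s|lborel. \<bar>f s - g s\<bar>)"
      using tr(2)[OF fg] .
    finally have "(LINT s|lborel. \<bar>f (s - h n) - f s\<bar>) < e" using g(2) n0[OF that] by linarith
    moreover have "(LINT s|lborel. \<bar>f (s - h n) - f s\<bar>) \<ge> 0" by simp
    ultimately show ?thesis by simp
  qed
  then show "\<exists>n0. \<forall>n\<ge>n0. norm ((LINT s|lborel. \<bar>f (s - h n) - f s\<bar>) - 0) < e" by blast
qed

text \<open>
  The indicator of an open set is lower semicontinuous, so by dominated convergence the part of \<open>U\<close>
  outside its translate vanishes; the other part of the symmetric difference has the same measure.
\<close>

lemma translation_L1_open:
  fixes U :: "real set"
  assumes U: "open U" "emeasure lborel U < \<infinity>" and h: "h \<longlonglongrightarrow> 0"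
  shows "(\<lambda>n. LINT s|lborel. \<bar>indicator U (s - h n) - indicator U s :: real\<bar>) \<longlonglongrightarrow> 0"
proof -
  have I: "integrable lborel (indicator U :: real \<Rightarrow> real)"
    using U by (simp add: integrable_indicator_iff)
  have I': "integrable lborel (\<lambda>s. indicator U (s - a) :: real)"
    "(LINT s|lborel. indicator U (s - a) :: real) = (LINT s|lborel. indicator U s)" for a
    using lborel_integrable_real_affine[OF I, of 1 "-a"]
      lborel_integral_real_affine[of 1 "indicator U :: real \<Rightarrow> real" "-a"] by simp_all
  have [measurable]: "U \<in> sets borel" using U(1) by auto
  define g where "g = (\<lambda>n s. indicator U s * (1 - indicator U (s - h n)) :: real)"
  have gI: "integrable lborel (g n)" for n
    unfolding g_def
    by (rule Bochner_Integration.integrable_bound[OF I])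
       (auto split: split_indicator)
  \<comment> \<open>Pointwise the absolute difference is \<open>2 * g n s\<close> plus the signed
    difference of the indicators, and the latter has integral 0 by translation invariance.\<close>
  have eq: "(LINT s|lborel. \<bar>indicator U (s - h n) - indicator U s :: real\<bar>) = 2 * (LINT s|lborel. g n s)" for n
  proof -
    have "(LINT s|lborel. \<bar>indicator U (s - h n) - indicator U s :: real\<bar>)
      = (LINT s|lborel. 2 * g n s + (indicator U (s - h n) - indicator U s))"
      by (rule Bochner_Integration.integral_cong) (auto simp: g_def indicator_def)
    also have "\<dots> = 2 * (LINT s|lborel. g n s)" using gI[of n] I'[of "h n"] I by simp
    finally show ?thesis .
  qed
  have "(\<lambda>n. LINT s|lborel. g n s) \<longlonglongrightarrow> (LINT s::real|lborel. (0::real))"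
  proof (rule integral_dominated_convergence[where w = "indicator U :: real \<Rightarrow> real"])
    show "g n \<in> borel_measurable lborel" for n using gI[of n] by auto
    show "AE x in lborel. norm (g n x) \<le> indicator U x" for n
      by (auto simp: g_def indicator_def)
    show "AE x in lborel. (\<lambda>n. g n x) \<longlonglongrightarrow> 0"
    proof (intro AE_I2)
      fix x
      show "(\<lambda>n. g n x) \<longlonglongrightarrow> 0"
      proof (cases "x \<in> U")
        case True
        have "(\<lambda>n. x - h n) \<longlonglongrightarrow> x - 0" by (intro tendsto_intros h)
        then have "eventually (\<lambda>n. x - h n \<in> U) sequentially"
          using U(1) True topological_tendstoD by fastforce
        then have "eventually (\<lambda>n. g n x = 0) sequentially"
          by eventually_elim (auto simp: g_def)
        then show ?thesis by (simp add: tendsto_eventually)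
      qed (simp add: g_def)
    qed
  qed (use I in auto)
  then show ?thesis unfolding eq using tendsto_mult_right_zero by auto
qed

lemma translation_L1:
  fixes f :: "real \<Rightarrow> real"
  assumes f: "integrable lborel f" and h: "h \<longlonglongrightarrow> 0"
  shows "(\<lambda>n. LINT s|lborel. \<bar>f (s - h n) - f s\<bar>) \<longlonglongrightarrow> 0"
  using f
proof (induction f rule: integrable_induct)
  case (base A c)
  have I: "integrable lborel (indicator A :: real \<Rightarrow> real)"
    using base by (simp add: integrable_indicator_iff)
  have *: "(\<lambda>n. LINT s|lborel. \<bar>indicator A (s - h n) - indicator A s :: real\<bar>) \<longlonglongrightarrow> 0"
  proof (rule translation_L1_approx[OF I])
    fix e :: real assume "e > 0"
    obtain U where U: "open U" "A \<subseteq> U" "emeasure lborel (U - A) < ennreal e"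
      using outer_regular_lborel[of A e] base \<open>e > 0\<close> by auto
    have UA: "emeasure lborel (U - A) < \<infinity>" using U(3) by (metis ennreal_less_top order_less_trans infinity_ennreal_def)
    have "emeasure lborel U \<le> emeasure lborel (A \<union> (U - A))"
      using U base by (intro emeasure_mono) auto
    also have "\<dots> \<le> emeasure lborel A + emeasure lborel (U - A)"
      using U base by (intro emeasure_subadditive) auto
    also have "\<dots> < \<infinity>" using base UA by simp
    finally have Uf: "emeasure lborel U < \<infinity>" .
    have "(LINT s|lborel. \<bar>indicator A s - indicator U s :: real\<bar>) = (LINT s|lborel. indicator (U - A) s)"
      using U(2) by (intro Bochner_Integration.integral_cong) (auto simp: indicator_def)
    also have "\<dots> = measure lborel (U - A)" by simp
    also have "\<dots> < e" using U(3) \<open>e > 0\<close> UA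
      by (metis emeasure_eq_ennreal_measure ennreal_less_iff infinity_ennreal_def less_top measure_nonneg order_less_irrefl)
    finally have "(LINT s|lborel. \<bar>indicator A s - indicator U s :: real\<bar>) < e" .
    moreover have "integrable lborel (indicator U :: real \<Rightarrow> real)"
      using U Uf by (simp add: integrable_indicator_iff)
    ultimately show "\<exists>g. integrable lborel g \<and> (LINT s|lborel. \<bar>indicator A s - g s\<bar>) < e \<and>
        (\<lambda>n. LINT s|lborel. \<bar>g (s - h n) - g s :: real\<bar>) \<longlonglongrightarrow> 0"
      using translation_L1_open[OF U(1) Uf h] by blast
  qed
  have "(LINT s|lborel. \<bar>indicator A (s - h n) *\<^sub>R c - indicator A s *\<^sub>R c\<bar>)
     = (LINT s|lborel. \<bar>indicator A (s - h n) - indicator A s :: real\<bar>) * \<bar>c\<bar>" for n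
  proof -
    have "(LINT s|lborel. \<bar>indicator A (s - h n) *\<^sub>R c - indicator A s *\<^sub>R c\<bar>)
     = (LINT s|lborel. \<bar>indicator A (s - h n) - indicator A s :: real\<bar> * \<bar>c\<bar>)"
      by (rule Bochner_Integration.integral_cong) (auto simp: indicator_def)
    then show ?thesis by simp
  qed
  then show ?case using tendsto_mult_left_zero[OF *] by simp
next
  case (add f g)
  have tr: "integrable lborel (\<lambda>s. k (s - a))" if "integrable lborel k" for a and k :: "real \<Rightarrow> real"
    using lborel_integrable_real_affine[OF that, of 1 "-a"] by (simp_all)
  show ?case
  proof (rule tendsto_sandwich[OF _ _ tendsto_const tendsto_add_zero[OF add(3,4)]])
    show "eventually (\<lambda>n. 0 \<le> (LINT s|lborel. \<bar>f (s - h n) + g (s - h n) - (f s + g s)\<bar>)) sequentially"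
      by simp
    have "(LINT s|lborel. \<bar>f (s - h n) + g (s - h n) - (f s + g s)\<bar>)
       \<le> (LINT s|lborel. \<bar>f (s - h n) - f s\<bar>) + (LINT s|lborel. \<bar>g (s - h n) - g s\<bar>)" for n
    proof -
      have "(LINT s|lborel. \<bar>f (s - h n) + g (s - h n) - (f s + g s)\<bar>)
          \<le> (LINT s|lborel. \<bar>f (s - h n) - f s\<bar> + \<bar>g (s - h n) - g s\<bar>)"
        using add(1,2) tr[of f "h n"] tr[of g "h n"] by (intro integral_mono) auto
      then show ?thesis using add(1,2) tr[of f "h n"] tr[of g "h n"] by simp
    qed
    then show "eventually (\<lambda>n. (LINT s|lborel. \<bar>f (s - h n) + g (s - h n) - (f s + g s)\<bar>)
       \<le> (LINT s|lborel. \<bar>f (s - h n) - f s\<bar>) + (LINT s|lborel. \<bar>g (s - h n) - g s\<bar>)) sequentially"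
      by simp
  qed
next
  case (lim f s)
  show ?case
  proof (rule translation_L1_approx[OF lim(4)])
    fix e :: real assume "e > 0"
    \<comment> \<open>The approximants of the induction rule satisfy
      \<open>\<bar>s i x\<bar> \<le> 2 * \<bar>f x\<bar>\<close>, whence the majorant
      \<open>3 * \<bar>f x\<bar>\<close>.\<close>
    have "(\<lambda>i. LINT x|lborel. \<bar>f x - s i x\<bar>) \<longlonglongrightarrow> (LINT x::real|lborel. (0::real))"
    proof (rule integral_dominated_convergence[where w = "\<lambda>x. 3 * \<bar>f x\<bar>"])
      show "AE x in lborel. (\<lambda>i. \<bar>f x - s i x\<bar>) \<longlonglongrightarrow> 0"
      proof (intro AE_I2)
        fix x
        have "(\<lambda>i. \<bar>f x - s i x\<bar>) \<longlonglongrightarrow> \<bar>f x - f x\<bar>" by (intro tendsto_intros lim(2)) simp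
        then show "(\<lambda>i. \<bar>f x - s i x\<bar>) \<longlonglongrightarrow> 0" by simp
      qed
      show "AE x in lborel. norm \<bar>f x - s i x\<bar> \<le> 3 * \<bar>f x\<bar>" for i
      proof (intro AE_I2)
        fix x show "norm \<bar>f x - s i x\<bar> \<le> 3 * \<bar>f x\<bar>" using lim(3)[of x i] by simp
      qed
      show "(\<lambda>x. \<bar>f x - s i x\<bar>) \<in> borel_measurable lborel" for i
        using lim(1,4) by (auto dest: borel_measurable_integrable)
    qed (use lim in auto)
    then obtain i where "\<bar>LINT x|lborel. \<bar>f x - s i x\<bar>\<bar> < e"
      using LIMSEQ_D[of _ 0 e] \<open>e > 0\<close> by fastforce
    then show "\<exists>g. integrable lborel g \<and> (LINT x|lborel. \<bar>f x - g x\<bar>) < e \<and>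
        (\<lambda>n. LINT x|lborel. \<bar>g (x - h n) - g x\<bar>) \<longlonglongrightarrow> 0"
      using lim(1,5) by auto
  qed
qed

subsection \<open>Transport with a prescribed promotion rate\<close>

text \<open>For fixed \<open>r\<close> the substitution \<open>x = s - t + r\<close> is a
  translation, so integrating along characteristics and then over \<open>s\<close> amounts to
  integrating over seniority at each time \<open>r\<close> and then over \<open>r\<close>. The bound
  \<open>K\<close>, uniform in \<open>r\<close>, supplies integrability on the product.\<close>

lemma characteristic_fubini:
  fixes h :: "real \<Rightarrow> real \<Rightarrow> real"
  assumes meas: "set_borel_measurable borel ({0..} \<times> {0..}) (\<lambda>(r, x). h r x)"
    and int: "\<forall>r\<in>{0..t}. set_integrable lborel {0..} (h r)"
    and bdd: "\<forall>r\<in>{0..t}. (LINT x:{0..}|lborel. \<bar>h r x\<bar>) \<le> K"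
  shows "AE s in lborel. s \<ge> 0 \<longrightarrow> set_integrable lborel {max 0 (t - s)..t} (\<lambda>r. h r (s - t + r))"
    and "set_integrable lborel {0..} (\<lambda>s. LINT r:{max 0 (t - s)..t}|lborel. h r (s - t + r))"
    and "(LINT s:{0..}|lborel. LINT r:{max 0 (t - s)..t}|lborel. h r (s - t + r))
      = (LINT r:{0..t}|lborel. LINT x:{0..}|lborel. h r x)"
    and "set_integrable lborel {0..t} (\<lambda>r. LINT x:{0..}|lborel. h r x)"
proof -
  define h0 where "h0 = (\<lambda>r x. indicator ({0..} \<times> {0..}) (r, x) * h r x)"
  have h0_meas [measurable]: "(\<lambda>(r, x). h0 r x) \<in> borel_measurable (borel \<Otimes>\<^sub>M borel)"
    using meas unfolding set_borel_measurable_def h0_def borel_prod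
    by (simp add: case_prod_unfold)
  \<comment> \<open>Extension by zero makes the limits of integration automatic: for
    \<open>s \<ge> 0\<close>, the point \<open>(r, s - t + r)\<close> lies in the quadrant exactly
    when \<open>r \<ge> max 0 (t - s)\<close>, and for \<open>s < 0\<close> it lies outside for all
    \<open>r \<le> t\<close>.\<close>
  define H where "H = (\<lambda>r s. indicator {0..t} r * h0 r (s - t + r))"
  have "(\<lambda>p. h0 (fst p) (snd p - t + fst p)) \<in> borel_measurable (lborel \<Otimes>\<^sub>M lborel)"
    using measurable_compose[of "\<lambda>p. (fst p, snd p - t + fst p)" "lborel \<Otimes>\<^sub>M lborel", OF _ h0_meas]
    by (simp add: case_prod_unfold)
  then have H_meas [measurable]: "(\<lambda>(r, s). H r s) \<in> borel_measurable (lborel \<Otimes>\<^sub>M lborel)"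
    unfolding H_def case_prod_unfold by (intro borel_measurable_times) auto
  have h0_r: "h0 r x = indicator {0..} x *\<^sub>R h r x" if "r \<in> {0..t}" for r x
    using that by (auto simp: h0_def indicator_def)
  have h0_int: "integrable lborel (h0 r)" if "r \<in> {0..t}" for r
    using bspec[OF int that] unfolding set_integrable_def h0_r[OF that, abs_def, symmetric] .
  have tr: "integrable lborel (\<lambda>s. k (s - t + r))" "(LINT s|lborel. k (s - t + r)) = (LINT s|lborel. k s)"
    if "integrable lborel k" for r and k :: "real \<Rightarrow> real"
    using lborel_integrable_real_affine[OF that, of 1 "r - t"]
      lborel_integral_real_affine[of 1 k "r - t"] by (simp_all add: algebra_simps)
  have H_int: "integrable lborel (H r)" for r
    using tr(1)[OF h0_int[of r], of r] by (cases "r \<in> {0..t}") (auto simp: H_def)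
  have H_norm: "(LINT s|lborel. norm (H r s)) = indicator {0..t} r * (LINT x:{0..}|lborel. \<bar>h r x\<bar>)" for r
  proof (cases "r \<in> {0..t}")
    case True
    then have "(LINT s|lborel. norm (H r s)) = (LINT s|lborel. \<bar>h0 r (s - t + r)\<bar>)"
      by (simp add: H_def)
    also have "\<dots> = (LINT s|lborel. \<bar>h0 r s\<bar>)"
      using tr(2)[of "\<lambda>s. \<bar>h0 r s\<bar>" r] h0_int[OF True] by simp
    also have "\<dots> = (LINT x:{0..}|lborel. \<bar>h r x\<bar>)"
      unfolding set_lebesgue_integral_def using True
      by (intro Bochner_Integration.integral_cong) (auto simp: h0_r abs_mult)
    finally show ?thesis using True by simp
  qed (simp add: H_def)
  have H_LINT: "(LINT s|lborel. H r s) = indicator {0..t} r *\<^sub>R (LINT x:{0..}|lborel. h r x)" for r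
  proof (cases "r \<in> {0..t}")
    case True
    then have "(LINT s|lborel. H r s) = (LINT s|lborel. h0 r (s - t + r))"
      by (simp add: H_def)
    also have "\<dots> = (LINT x:{0..}|lborel. h r x)"
      unfolding set_lebesgue_integral_def using True tr(2)[OF h0_int[OF True], of r] by (simp add: h0_r)
    finally show ?thesis using True by simp
  qed (simp add: H_def)
  have H_pair: "integrable (lborel \<Otimes>\<^sub>M lborel) (\<lambda>(r, s). H r s)"
  proof (rule lborel_pair.Fubini_integrable)
    show "integrable lborel (\<lambda>x. LINT y|lborel. norm (case (x, y) of (r, s) \<Rightarrow> H r s))"
    proof (rule Bochner_Integration.integrable_bound)
      show "integrable lborel (\<lambda>r. indicator {0..t} r * K)"
        by (intro integrable_mult_left) (simp add: integrable_indicator_iff emeasure_lborel_Icc_eq)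
      show "AE r in lborel. norm (LINT y|lborel. norm (case (r, y) of (r, s) \<Rightarrow> H r s)) \<le> norm (indicator {0..t} r * K)"
      proof (intro AE_I2)
        fix r
        have "0 \<le> (LINT x:{0..}|lborel. \<bar>h r x\<bar>)"
          unfolding set_lebesgue_integral_def by (intro integral_nonneg_AE) auto
        then show "norm (LINT y|lborel. norm (case (r, y) of (r, s) \<Rightarrow> H r s)) \<le> norm (indicator {0..t} r * K)"
          using bdd[THEN bspec, of r] H_norm[of r] by (cases "r \<in> {0..t}") auto
      qed
    qed measurable
  qed (auto simp: H_int)
  have H_s: "indicator {max 0 (t - s)..t} r *\<^sub>R h r (s - t + r) = H r s" if "s \<ge> 0" for r s
    using that by (auto simp: H_def h0_def indicator_def)
  have H_neg: "H r s = 0" if "s < 0" for r s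
    using that by (auto simp: H_def h0_def indicator_def)
  have eq: "indicator {0..} s *\<^sub>R (LINT r:{max 0 (t - s)..t}|lborel. h r (s - t + r)) = (LINT r|lborel. H r s)" for s
    unfolding set_lebesgue_integral_def by (cases "s \<ge> 0") (simp_all add: H_s H_neg del: real_scaleR_def)
  show "AE s in lborel. s \<ge> 0 \<longrightarrow> set_integrable lborel {max 0 (t - s)..t} (\<lambda>r. h r (s - t + r))"
    using lborel_pair.AE_integrable_snd[OF H_pair] unfolding set_integrable_def
    by eventually_elim (simp add: H_s del: real_scaleR_def)
  show "set_integrable lborel {0..} (\<lambda>s. LINT r:{max 0 (t - s)..t}|lborel. h r (s - t + r))"
    using lborel_pair.integrable_snd[OF H_pair] unfolding set_integrable_def eq by simp
  show "set_integrable lborel {0..t} (\<lambda>r. LINT x:{0..}|lborel. h r x)"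
    using lborel_pair.integrable_fst[OF H_pair] unfolding set_integrable_def H_LINT by simp
  show "(LINT s:{0..}|lborel. LINT r:{max 0 (t - s)..t}|lborel. h r (s - t + r))
      = (LINT r:{0..t}|lborel. LINT x:{0..}|lborel. h r x)"
    using lborel_pair.Fubini_integral[OF H_pair]
    unfolding H_LINT eq[symmetric] set_lebesgue_integral_def by simp
qed

section \<open>Mild solutions for a given rate: continuity, uniqueness, mass balance\<close>

text \<open>The equation of one level in \<open>is_solution\<close>, with the rate \<open>q\<close>
  decoupled from \<open>u\<close>. This makes it affine in \<open>u\<close>, so that differences of
  solutions can be estimated; the nonlinear problem is recovered by choosing for \<open>q\<close>
  the rate computed from \<open>u\<close> itself.\<close>

definition mild_solution ::
  "real \<Rightarrow> real \<Rightarrow> real \<Rightarrow> (real \<Rightarrow> real) \<Rightarrow> (real \<Rightarrow> real \<Rightarrow> real) \<Rightarrow> bool" where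
  "mild_solution \<mu> \<tau> b q u \<longleftrightarrow>
     set_borel_measurable borel ({0..} \<times> {0..}) (\<lambda>(t, s). u t s) \<and>
     continuous_in_L1 u \<and>
     (\<forall>t\<ge>0. AE s in lborel. s \<ge> 0 \<longrightarrow>
        set_integrable lborel {max 0 (t - s)..t}
          (\<lambda>r. (\<mu> + q r * indicator {\<tau>..} (s - t + r)) * u r (s - t + r)) \<and>
        u t s = (if s \<ge> t then u 0 (s - t) else b)
          - (LINT r:{max 0 (t - s)..t}|lborel.
               (\<mu> + q r * indicator {\<tau>..} (s - t + r)) * u r (s - t + r)))"

text \<open>A functional that is 1-Lipschitz in L1 turns an L1-continuous curve into a continuous
  real function. It is applied to integrals over a set and to the norm.\<close>

lemma continuous_in_L1_functional:
  assumes u: "continuous_in_L1 u"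
    and lip: "\<And>t t'. t \<ge> 0 \<Longrightarrow> t' \<ge> 0 \<Longrightarrow>
      \<bar>\<Phi> (u t') - \<Phi> (u t)\<bar> \<le> (LINT s:{0..}|lborel. \<bar>u t' s - u t s\<bar>)"
  shows "continuous_on {0..} (\<lambda>t. \<Phi> (u t))"
  unfolding continuous_on_def
proof
  fix t :: real assume t: "t \<in> {0..}"
  have "((\<lambda>t'. LINT s:{0..}|lborel. \<bar>u t' s - u t s\<bar>) \<longlongrightarrow> 0) (at t within {0..})"
    using u t unfolding continuous_in_L1_def by auto
  moreover have "eventually (\<lambda>t'. norm (\<Phi> (u t') - \<Phi> (u t)) \<le> (LINT s:{0..}|lborel. \<bar>u t' s - u t s\<bar>))
      (at t within {0..})"
    using lip t by (auto simp: eventually_at_filter)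
  ultimately have "((\<lambda>t'. \<Phi> (u t') - \<Phi> (u t)) \<longlongrightarrow> 0) (at t within {0..})"
    by (rule Lim_null_comparison[rotated])
  then show "((\<lambda>t. \<Phi> (u t)) \<longlongrightarrow> \<Phi> (u t)) (at t within {0..})"
    by (simp add: LIM_zero_iff)
qed

lemma set_integral_abs_mono_set:
  fixes f :: "real \<Rightarrow> real"
  assumes "set_integrable lborel B f" "A \<subseteq> B" "A \<in> sets borel"
  shows "\<bar>LINT s:A|lborel. f s\<bar> \<le> (LINT s:B|lborel. \<bar>f s\<bar>)"
proof -
  have A: "set_integrable lborel A f" using assms by (auto intro: set_integrable_subset)
  have "\<bar>LINT s:A|lborel. f s\<bar> \<le> (LINT s:A|lborel. \<bar>f s\<bar>)"
    using integral_abs_bound[of lborel "\<lambda>s. indicator A s *\<^sub>R f s"]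
    by (simp add: set_lebesgue_integral_def abs_mult)
  also have "\<dots> \<le> (LINT s:B|lborel. \<bar>f s\<bar>)"
    using set_integrable_abs[OF A] set_integrable_abs[OF assms(1)] assms(2)
    unfolding set_lebesgue_integral_def set_integrable_def
    by (intro integral_mono) (auto simp: indicator_def)
  finally show ?thesis .
qed

lemma continuous_in_L1_integral:
  assumes u: "continuous_in_L1 u" and A: "A \<in> sets borel" "A \<subseteq> {0..}"
  shows "continuous_on {0..} (\<lambda>t. LINT s:A|lborel. u t s)"
proof (rule continuous_in_L1_functional[OF u, where \<Phi> = "\<lambda>f. LINT s:A|lborel. f s"])
  fix t t' :: real assume t: "t \<ge> 0" "t' \<ge> 0"
  have i: "set_integrable lborel {0..} (u t)" "set_integrable lborel {0..} (u t')"
    using u t by (auto simp: continuous_in_L1_def)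
  then have "set_integrable lborel A (u t)" "set_integrable lborel A (u t')"
    using A by (auto intro: set_integrable_subset)
  then have "(LINT s:A|lborel. u t' s) - (LINT s:A|lborel. u t s) = (LINT s:A|lborel. u t' s - u t s)"
    by simp
  also have "\<bar>\<dots>\<bar> \<le> (LINT s:{0..}|lborel. \<bar>u t' s - u t s\<bar>)"
    using A i by (intro set_integral_abs_mono_set) auto
  finally show "\<bar>(LINT s:A|lborel. u t' s) - (LINT s:A|lborel. u t s)\<bar>
      \<le> (LINT s:{0..}|lborel. \<bar>u t' s - u t s\<bar>)" .
qed

lemma continuous_in_L1_norm:
  assumes u: "continuous_in_L1 u"
  shows "continuous_on {0..} (\<lambda>t. LINT s:{0..}|lborel. \<bar>u t s\<bar>)"
proof (rule continuous_in_L1_functional[OF u, where \<Phi> = "\<lambda>f. LINT s:{0..}|lborel. \<bar>f s\<bar>"])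
  fix t t' :: real assume t: "t \<ge> 0" "t' \<ge> 0"
  have i: "set_integrable lborel {0..} (u t)" "set_integrable lborel {0..} (u t')"
    using u t by (auto simp: continuous_in_L1_def)
  note ia = i[THEN set_integrable_abs]
  have "\<bar>(LINT s:{0..}|lborel. \<bar>u t' s\<bar>) - (LINT s:{0..}|lborel. \<bar>u t s\<bar>)\<bar>
      = \<bar>LINT s:{0..}|lborel. \<bar>u t' s\<bar> - \<bar>u t s\<bar>\<bar>" using ia by simp
  also have "\<dots> \<le> (LINT s:{0..}|lborel. \<bar>\<bar>u t' s\<bar> - \<bar>u t s\<bar>\<bar>)"
    using ia by (intro set_integral_abs_mono_set) auto
  also have "\<dots> \<le> (LINT s:{0..}|lborel. \<bar>u t' s - u t s\<bar>)"
    using ia i by (intro set_integral_mono set_integrable_abs set_integral_diff) auto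
  finally show "\<bar>(LINT s:{0..}|lborel. \<bar>u t' s\<bar>) - (LINT s:{0..}|lborel. \<bar>u t s\<bar>)\<bar>
      \<le> (LINT s:{0..}|lborel. \<bar>u t' s - u t s\<bar>)" .
qed

lemma continuous_in_L1_diff:
  assumes u: "continuous_in_L1 u" and v: "continuous_in_L1 v"
  shows "continuous_in_L1 (\<lambda>t s. u t s - v t s)"
  unfolding continuous_in_L1_def
proof (intro conjI allI impI)
  fix t :: real assume t: "t \<ge> 0"
  have i: "set_integrable lborel {0..} (u r)" "set_integrable lborel {0..} (v r)" if "r \<ge> 0" for r
    using u v that by (auto simp: continuous_in_L1_def)
  show "set_integrable lborel {0..} (\<lambda>s. u t s - v t s)" using i[OF t] by (rule set_integral_diff)
  have lim: "((\<lambda>t'. (LINT s:{0..}|lborel. \<bar>u t' s - u t s\<bar>) + (LINT s:{0..}|lborel. \<bar>v t' s - v t s\<bar>)) \<longlongrightarrow> 0)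
      (at t within {0..})"
    using u v t by (intro tendsto_add_zero) (auto simp: continuous_in_L1_def)
  have "norm (LINT s:{0..}|lborel. \<bar>u t' s - v t' s - (u t s - v t s)\<bar>)
      \<le> (LINT s:{0..}|lborel. \<bar>u t' s - u t s\<bar>) + (LINT s:{0..}|lborel. \<bar>v t' s - v t s\<bar>)"
    if t': "t' \<ge> 0" for t'
  proof -
    note i1 = set_integrable_abs[OF set_integral_diff(1)[OF i(1)[OF t'] i(1)[OF t]]]
    note i2 = set_integrable_abs[OF set_integral_diff(1)[OF i(2)[OF t'] i(2)[OF t]]]
    have "norm (LINT s:{0..}|lborel. \<bar>u t' s - v t' s - (u t s - v t s)\<bar>)
      = (LINT s:{0..}|lborel. \<bar>u t' s - v t' s - (u t s - v t s)\<bar>)"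
      by (simp add: set_lebesgue_integral_def)
    also have "\<dots> \<le> (LINT s:{0..}|lborel. \<bar>u t' s - u t s\<bar> + \<bar>v t' s - v t s\<bar>)"
      using i[OF t] i[OF t'] i1 i2
      by (intro set_integral_mono set_integral_add set_integrable_abs set_integral_diff) auto
    also have "\<dots> = (LINT s:{0..}|lborel. \<bar>u t' s - u t s\<bar>) + (LINT s:{0..}|lborel. \<bar>v t' s - v t s\<bar>)"
      using i1 i2 by (rule set_integral_add)
    finally show ?thesis .
  qed
  then show "((\<lambda>t'. LINT s:{0..}|lborel. \<bar>u t' s - v t' s - (u t s - v t s)\<bar>) \<longlongrightarrow> 0) (at t within {0..})"
    by (intro Lim_null_comparison[OF _ lim]) (auto simp: eventually_at_filter)
qed

lemma set_borel_measurable_rate_mult: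
  fixes q :: "real \<Rightarrow> real" and w :: "real \<Rightarrow> real \<Rightarrow> real"
  assumes q: "continuous_on {0..} q"
    and w: "set_borel_measurable borel ({0..} \<times> {0..}) (\<lambda>(r, x). w r x)"
  shows "set_borel_measurable borel ({0..} \<times> {0..})
    (\<lambda>(r, x). (\<mu> + q r * indicator {\<tau>..} x) * w r x)"
proof -
  define q0 where "q0 = (\<lambda>r. indicator {0..} r *\<^sub>R q r :: real)"
  have [measurable]: "q0 \<in> borel_measurable borel"
    unfolding q0_def by (rule borel_measurable_continuous_on_indicator[OF _ q]) auto
  define w0 where "w0 = (\<lambda>p. indicator ({0..} \<times> {0..}) p *\<^sub>R (case p of (r, x) \<Rightarrow> w r x))"
  have [measurable]: "w0 \<in> borel_measurable (borel \<Otimes>\<^sub>M borel)"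
    using w unfolding w0_def set_borel_measurable_def borel_prod .
  have eq: "(\<lambda>p. indicator ({0..} \<times> {0..}) p *\<^sub>R (case p of (r, x) \<Rightarrow> (\<mu> + q r * indicator {\<tau>..} x) * w r x))
    = (\<lambda>p. (\<mu> + q0 (fst p) * indicator {\<tau>..} (snd p)) * w0 p)"
    by (auto simp: fun_eq_iff q0_def w0_def split: split_indicator)
  show ?thesis
    unfolding set_borel_measurable_def eq borel_prod[symmetric] by measurable
qed

lemma set_borel_measurable_diff_abs:
  assumes "set_borel_measurable M A (\<lambda>(r, x). u r x)" "set_borel_measurable M A (\<lambda>(r, x). v r x)"
  shows "set_borel_measurable M A (\<lambda>(r, x). K * \<bar>u r x - v r x :: real\<bar>)"
proof -
  have "(\<lambda>p. K * \<bar>indicator A p *\<^sub>R (case p of (r, x) \<Rightarrow> u r x) - indicator A p *\<^sub>R (case p of (r, x) \<Rightarrow> v r x)\<bar>)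
    \<in> borel_measurable M"
    using assms unfolding set_borel_measurable_def by measurable
  also have "(\<lambda>p. K * \<bar>indicator A p *\<^sub>R (case p of (r, x) \<Rightarrow> u r x) - indicator A p *\<^sub>R (case p of (r, x) \<Rightarrow> v r x)\<bar>)
    = (\<lambda>p. indicator A p *\<^sub>R (case p of (r, x) \<Rightarrow> K * \<bar>u r x - v r x\<bar>))"
    by (auto simp: fun_eq_iff split: split_indicator)
  finally show ?thesis unfolding set_borel_measurable_def .
qed

lemma continuous_on_Icc_bound:
  fixes f :: "real \<Rightarrow> real"
  assumes "continuous_on {0..} f"
  obtains K where "K \<ge> 0" "\<And>r. r \<in> {0..t} \<Longrightarrow> \<bar>f r\<bar> \<le> K"
proof -
  have "compact (f ` {0..t})"
    by (intro compact_continuous_image continuous_on_subset[OF assms]) auto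
  then obtain K where "\<forall>r\<in>{0..t}. \<bar>f r\<bar> \<le> K"
    using compact_imp_bounded[of "f ` {0..t}"] unfolding bounded_iff by auto
  then have "\<And>r. r \<in> {0..t} \<Longrightarrow> \<bar>f r\<bar> \<le> max K 0" by (simp add: le_max_iff_disj)
  then show ?thesis using that[of "max K 0"] by auto
qed

lemma set_integrable_rate_mult:
  fixes f :: "real \<Rightarrow> real"
  assumes "set_integrable lborel {0..} f" "\<tau> \<ge> 0"
  shows "set_integrable lborel {0..} (\<lambda>x. (\<mu> + c * indicator {\<tau>..} x) * f x)"
    and "(LINT x:{0..}|lborel. (\<mu> + c * indicator {\<tau>..} x) * f x)
      = \<mu> * (LINT x:{0..}|lborel. f x) + c * (LINT x:{\<tau>..}|lborel. f x)"
proof -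
  have i: "integrable lborel (\<lambda>x. indicator {0..} x *\<^sub>R f x)" using assms by (simp add: set_integrable_def)
  have "set_integrable lborel {\<tau>..} f" using assms by (auto intro: set_integrable_subset)
  then have i': "integrable lborel (\<lambda>x. indicator {\<tau>..} x *\<^sub>R f x)" by (simp add: set_integrable_def)
  have eq: "indicator {0..} x *\<^sub>R ((\<mu> + c * indicator {\<tau>..} x) * f x)
    = \<mu> * (indicator {0..} x *\<^sub>R f x) + c * (indicator {\<tau>..} x *\<^sub>R f x)" for x
    using assms(2) by (auto simp: indicator_def algebra_simps)
  show "set_integrable lborel {0..} (\<lambda>x. (\<mu> + c * indicator {\<tau>..} x) * f x)"
    unfolding set_integrable_def eq using i i' by (intro Bochner_Integration.integrable_add integrable_mult_right) auto
  show "(LINT x:{0..}|lborel. (\<mu> + c * indicator {\<tau>..} x) * f x)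
      = \<mu> * (LINT x:{0..}|lborel. f x) + c * (LINT x:{\<tau>..}|lborel. f x)"
    unfolding set_lebesgue_integral_def eq using i i' by simp
qed

lemma continuous_set_integral_eq:
  fixes f :: "real \<Rightarrow> real"
  assumes "continuous_on {0..} f"
  shows "(LINT r:{0..t}|lborel. f r) = integral {0..t} f"
  using assms by (intro set_borel_integral_eq_integral borel_integrable_atLeastAtMost' continuous_on_subset[OF assms]) auto

lemma set_lebesgue_integral_cong_AE_on:
  assumes "set_borel_measurable M A f" "set_borel_measurable M A g"
    and "AE x in M. x \<in> A \<longrightarrow> f x = g x"
  shows "(LINT x:A|M. f x) = (LINT x:A|M. g x)"
  unfolding set_lebesgue_integral_def
  using assms by (intro integral_cong_AE) (auto simp: set_borel_measurable_def indicator_def)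

text \<open>In the difference \<open>w\<close> the initial and boundary values cancel, so
  \<open>\<bar>w\<bar>\<close> is at most the integral of \<open>K * \<bar>w\<bar>\<close> along the
  characteristic. Integrating over seniority and exchanging the integrals gives the Gronwall
  inequality for the L1 norm of \<open>w\<close>.\<close>

lemma mild_solution_unique:
  assumes u: "mild_solution \<mu> \<tau> b q u" and v: "mild_solution \<mu> \<tau> b q v"
    and q: "continuous_on {0..} q"
    and init: "AE s in lborel. s \<ge> 0 \<longrightarrow> u 0 s = v 0 s" and t: "t \<ge> 0"
  shows "AE s in lborel. s \<ge> 0 \<longrightarrow> u t s = v t s"
proof -
  \<comment> \<open>The bounds on \<open>q\<close> and \<open>f\<close> are uniform only on bounded
    intervals, so the final time is fixed before \<open>t\<close> is reused as a running
    time.\<close>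
  define T where "T = t"
  define w where "w = (\<lambda>t s. u t s - v t s)"
  define f where "f = (\<lambda>t. LINT s:{0..}|lborel. \<bar>w t s\<bar>)"
  have wc: "continuous_in_L1 w"
    unfolding w_def using u v by (auto simp: mild_solution_def intro: continuous_in_L1_diff)
  have fc: "continuous_on {0..} f" unfolding f_def by (rule continuous_in_L1_norm[OF wc])
  have wi: "set_integrable lborel {0..} (w r)" if "r \<ge> 0" for r
    using wc that by (simp add: continuous_in_L1_def)
  obtain Kq where Kq: "Kq \<ge> 0" "\<And>r. r \<in> {0..T} \<Longrightarrow> \<bar>q r\<bar> \<le> Kq" using continuous_on_Icc_bound[OF q] by blast
  obtain Kf where Kf: "\<And>r. r \<in> {0..T} \<Longrightarrow> \<bar>f r\<bar> \<le> Kf" using continuous_on_Icc_bound[OF fc] by blast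
  define K where "K = \<bar>\<mu>\<bar> + Kq"
  have K: "K \<ge> 0" using Kq by (simp add: K_def)
  have kK: "\<bar>\<mu> + q r * indicator {\<tau>..} x\<bar> \<le> K" if "r \<in> {0..T}" for r x
    using Kq(2)[OF that] Kq(1) by (auto simp: K_def indicator_def)
  have le: "f t \<le> K * integral {0..t} f" if t: "t \<in> {0..T}" for t
  proof -
    define h where "h = (\<lambda>r x. K * \<bar>w r x\<bar>)"
    have h_meas: "set_borel_measurable borel ({0..} \<times> {0..}) (\<lambda>(r, x). h r x)"
      unfolding h_def w_def using u v by (intro set_borel_measurable_diff_abs) (auto simp: mild_solution_def)
    have h_int: "set_integrable lborel {0..} (h r)" if "r \<in> {0..t}" for r
      unfolding h_def using wi[of r] that by (intro set_integrable_mult_right set_integrable_abs) auto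
    have h_bdd: "(LINT x:{0..}|lborel. \<bar>h r x\<bar>) \<le> K * Kf" if "r \<in> {0..t}" for r
    proof -
      have "(LINT x:{0..}|lborel. \<bar>h r x\<bar>) = K * f r" using K by (simp add: h_def f_def abs_mult)
      also have "\<dots> \<le> K * Kf" using Kf[of r] that t K by (intro mult_left_mono) auto
      finally show ?thesis .
    qed
    have "\<forall>r\<in>{0..t}. set_integrable lborel {0..} (h r)"
      "\<forall>r\<in>{0..t}. (LINT x:{0..}|lborel. \<bar>h r x\<bar>) \<le> K * Kf"
      using h_int h_bdd by blast+
    note fub = characteristic_fubini[OF h_meas this]
    \<comment> \<open>Translations preserve null sets, so the initial values also agree at the feet
      of almost all characteristics.\<close>
    have "AE s in lborel. s \<ge> t \<longrightarrow> u 0 (s - t) = v 0 (s - t)"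
    proof -
      have "AE s in distr lborel borel ((+) (- t)). s \<ge> 0 \<longrightarrow> u 0 s = v 0 s"
        unfolding lborel_distr_plus by (rule init)
      from AE_distrD[OF _ this] show ?thesis by simp
    qed
    moreover have "AE s in lborel. s \<ge> 0 \<longrightarrow>
        set_integrable lborel {max 0 (t - s)..t} (\<lambda>r. (\<mu> + q r * indicator {\<tau>..} (s - t + r)) * u r (s - t + r)) \<and>
        u t s = (if s \<ge> t then u 0 (s - t) else b)
          - (LINT r:{max 0 (t - s)..t}|lborel. (\<mu> + q r * indicator {\<tau>..} (s - t + r)) * u r (s - t + r))"
      using u t by (auto simp: mild_solution_def)
    moreover have "AE s in lborel. s \<ge> 0 \<longrightarrow>
        set_integrable lborel {max 0 (t - s)..t} (\<lambda>r. (\<mu> + q r * indicator {\<tau>..} (s - t + r)) * v r (s - t + r)) \<and>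
        v t s = (if s \<ge> t then v 0 (s - t) else b)
          - (LINT r:{max 0 (t - s)..t}|lborel. (\<mu> + q r * indicator {\<tau>..} (s - t + r)) * v r (s - t + r))"
      using v t by (auto simp: mild_solution_def)
    ultimately have AE: "AE s in lborel. s \<ge> 0 \<longrightarrow>
        \<bar>w t s\<bar> \<le> (LINT r:{max 0 (t - s)..t}|lborel. h r (s - t + r))"
      using fub(1)
    proof eventually_elim
      case (elim s)
      show ?case
      proof
        assume s: "s \<ge> 0"
        let ?I = "{max 0 (t - s)..t}"
        let ?g = "\<lambda>r. (\<mu> + q r * indicator {\<tau>..} (s - t + r)) * w r (s - t + r)"
        have i: "set_integrable lborel ?I ?g"
          using elim s set_integral_diff(1)[of lborel ?I
              "\<lambda>r. (\<mu> + q r * indicator {\<tau>..} (s - t + r)) * u r (s - t + r)"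
              "\<lambda>r. (\<mu> + q r * indicator {\<tau>..} (s - t + r)) * v r (s - t + r)"]
          by (simp add: w_def algebra_simps)
        have "w t s = - (LINT r:?I|lborel. ?g r)"
          using elim s set_integral_diff(2)[of lborel ?I
              "\<lambda>r. (\<mu> + q r * indicator {\<tau>..} (s - t + r)) * u r (s - t + r)"
              "\<lambda>r. (\<mu> + q r * indicator {\<tau>..} (s - t + r)) * v r (s - t + r)"]
          by (simp add: w_def right_diff_distrib split: if_splits)
        then have "\<bar>w t s\<bar> \<le> (LINT r:?I|lborel. \<bar>?g r\<bar>)"
          using set_integral_abs_mono_set[OF i, of ?I] by simp
        also have "\<dots> \<le> (LINT r:?I|lborel. h r (s - t + r))"
        proof (intro set_integral_mono set_integrable_abs i)
          show "set_integrable lborel ?I (\<lambda>r. h r (s - t + r))" using elim s by simp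
          fix r assume "r \<in> ?I"
          then have "r \<in> {0..T}" using t by auto
          then show "\<bar>?g r\<bar> \<le> h r (s - t + r)"
            using kK[of r "s - t + r"] unfolding h_def abs_mult by (intro mult_right_mono) auto
        qed
        finally show "\<bar>w t s\<bar> \<le> (LINT r:?I|lborel. h r (s - t + r))" .
      qed
    qed
    have "f t \<le> (LINT s:{0..}|lborel. LINT r:{max 0 (t - s)..t}|lborel. h r (s - t + r))"
      unfolding f_def
      by (intro set_integral_mono_AE set_integrable_abs wi fub(2)) (use t AE in \<open>auto\<close>)
    also have "\<dots> = (LINT r:{0..t}|lborel. K * f r)"
      unfolding fub(3) by (simp add: h_def f_def)
    also have "\<dots> = K * integral {0..t} f" using continuous_set_integral_eq[OF fc] by simp
    finally show ?thesis .
  qed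
  have "f T = 0"
  proof (rule gronwall_zero[OF _ _ K le])
    show "continuous_on {0..T} f" by (rule continuous_on_subset[OF fc]) auto
    show "T \<in> {0..T}" using t by (simp add: T_def)
  qed (auto simp: f_def set_lebesgue_integral_def)
  moreover have "integrable lborel (\<lambda>s. indicator {0..} s *\<^sub>R \<bar>w T s\<bar>)"
    using set_integrable_abs[OF wi] t by (simp add: T_def set_integrable_def)
  ultimately have "AE s in lborel. indicator {0..} s *\<^sub>R \<bar>w T s\<bar> = 0"
    unfolding f_def set_lebesgue_integral_def by (subst (asm) integral_nonneg_eq_0_iff_AE) auto
  then show ?thesis by eventually_elim (auto simp: w_def T_def)
qed

text \<open>The equation is integrated over seniority. Characteristics that start on the boundary
  fill \<open>{0..<t}\<close> and contribute \<open>b * t\<close>; the others carry the initial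
  mass; the loss becomes a time integral by \<open>characteristic_fubini\<close>. For a
  \<open>u\<close> constant in time with constant \<open>q\<close> this is the algebraic balance of
  recruitment and losses.\<close>

lemma mild_solution_mass:
  assumes u: "mild_solution \<mu> \<tau> b q u"
    and q: "continuous_on {0..} q" and \<tau>: "\<tau> \<ge> 0" and t: "t \<ge> 0"
  shows "(LINT s:{0..}|lborel. u t s) = (LINT s:{0..}|lborel. u 0 s) + b * t
    - integral {0..t} (\<lambda>r. \<mu> * (LINT s:{0..}|lborel. u r s) + q r * (LINT s:{\<tau>..}|lborel. u r s))"
proof -
  have uc: "continuous_in_L1 u" using u by (simp add: mild_solution_def)
  have ui: "set_integrable lborel {0..} (u r)" if "r \<ge> 0" for r
    using uc that by (simp add: continuous_in_L1_def)
  define h where "h = (\<lambda>r x. (\<mu> + q r * indicator {\<tau>..} x) * u r x)"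
  obtain Kq where Kq: "Kq \<ge> 0" "\<And>r. r \<in> {0..t} \<Longrightarrow> \<bar>q r\<bar> \<le> Kq" using continuous_on_Icc_bound[OF q] by blast
  obtain Kf where Kf: "\<And>r. r \<in> {0..t} \<Longrightarrow> \<bar>LINT s:{0..}|lborel. \<bar>u r s\<bar>\<bar> \<le> Kf"
    using continuous_on_Icc_bound[OF continuous_in_L1_norm[OF uc]] by blast
  define K where "K = \<bar>\<mu>\<bar> + Kq"
  have K: "K \<ge> 0" using Kq by (simp add: K_def)
  have kK: "\<bar>\<mu> + q r * indicator {\<tau>..} x\<bar> \<le> K" if "r \<in> {0..t}" for r x
    using Kq(2)[OF that] Kq(1) by (auto simp: K_def indicator_def)
  have h_meas: "set_borel_measurable borel ({0..} \<times> {0..}) (\<lambda>(r, x). h r x)"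
    unfolding h_def using u q by (intro set_borel_measurable_rate_mult) (auto simp: mild_solution_def)
  have h_int: "set_integrable lborel {0..} (h r)" if "r \<in> {0..t}" for r
    unfolding h_def using that \<tau> by (intro set_integrable_rate_mult ui) auto
  have h_bdd: "(LINT x:{0..}|lborel. \<bar>h r x\<bar>) \<le> K * Kf" if r: "r \<in> {0..t}" for r
  proof -
    have "(LINT x:{0..}|lborel. \<bar>h r x\<bar>) \<le> (LINT x:{0..}|lborel. K * \<bar>u r x\<bar>)"
    proof (intro set_integral_mono set_integrable_abs set_integrable_mult_right h_int ui r)
      show "\<bar>h r x\<bar> \<le> K * \<bar>u r x\<bar>" for x
        using kK[OF r, of x] unfolding h_def abs_mult by (intro mult_right_mono) auto
    qed (use r in auto)
    also have "\<dots> \<le> K * Kf" using Kf[OF r] K by (simp add: mult_left_mono)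
    finally show ?thesis .
  qed
  have "\<forall>r\<in>{0..t}. set_integrable lborel {0..} (h r)"
      "\<forall>r\<in>{0..t}. (LINT x:{0..}|lborel. \<bar>h r x\<bar>) \<le> K * Kf"
      using h_int h_bdd by blast+
    note fub = characteristic_fubini[OF h_meas this]
  have AE: "AE s in lborel. s \<in> {0..} \<longrightarrow> u t s = (if s \<ge> t then u 0 (s - t) else b)
          - (LINT r:{max 0 (t - s)..t}|lborel. h r (s - t + r))"
    using u t by (auto simp: mild_solution_def h_def elim: eventually_mono)
  have u0: "integrable lborel (\<lambda>s. indicator {0..} s *\<^sub>R u 0 s)" using ui[of 0] by (simp add: set_integrable_def)
  have s0: "integrable lborel (\<lambda>s. indicator {0..} (s - t) *\<^sub>R u 0 (s - t))"
    "(LINT s|lborel. indicator {0..} (s - t) *\<^sub>R u 0 (s - t)) = (LINT s:{0..}|lborel. u 0 s)"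
    using lborel_integrable_real_affine[OF u0, of 1 "-t"]
      lborel_integral_real_affine[of 1 "\<lambda>s. indicator {0..} s *\<^sub>R u 0 s" "-t"]
    by (simp_all add: set_lebesgue_integral_def)
  have eq: "indicator {0..} s *\<^sub>R (if s \<ge> t then u 0 (s - t) else b)
    = indicator {0..} (s - t) *\<^sub>R u 0 (s - t) + indicator {0..<t} s * b" for s
    using t by (auto simp: indicator_def)
  have ib: "integrable lborel (\<lambda>s. indicator {0..<t} s * b)"
    using t by (intro integrable_mult_left) (simp add: integrable_indicator_iff)
  have I: "set_integrable lborel {0..} (\<lambda>s. if s \<ge> t then u 0 (s - t) else b)"
    unfolding set_integrable_def eq using s0(1) ib by (rule Bochner_Integration.integrable_add)
  have I_eq: "(LINT s:{0..}|lborel. if s \<ge> t then u 0 (s - t) else b) = (LINT s:{0..}|lborel. u 0 s) + b * t"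
    unfolding set_lebesgue_integral_def eq using s0 ib t
    by (simp add: set_lebesgue_integral_def)
  have "(LINT s:{0..}|lborel. u t s) = (LINT s:{0..}|lborel. (if s \<ge> t then u 0 (s - t) else b)
          - (LINT r:{max 0 (t - s)..t}|lborel. h r (s - t + r)))"
  proof (rule set_lebesgue_integral_cong_AE_on[OF _ _ AE])
    show "set_borel_measurable lborel {0..} (u t)"
      using ui[OF t] by (auto simp: set_integrable_def set_borel_measurable_def)
    show "set_borel_measurable lborel {0..} (\<lambda>s. (if s \<ge> t then u 0 (s - t) else b)
          - (LINT r:{max 0 (t - s)..t}|lborel. h r (s - t + r)))"
      using set_integral_diff(1)[OF I fub(2)] by (auto simp: set_integrable_def set_borel_measurable_def)
  qed
  also have "\<dots> = (LINT s:{0..}|lborel. u 0 s) + b * t - (LINT r:{0..t}|lborel. LINT x:{0..}|lborel. h r x)"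
    using set_integral_diff(2)[OF I fub(2)] I_eq fub(3) by simp
  also have "(LINT r:{0..t}|lborel. LINT x:{0..}|lborel. h r x)
    = (LINT r:{0..t}|lborel. \<mu> * (LINT s:{0..}|lborel. u r s) + q r * (LINT s:{\<tau>..}|lborel. u r s))"
    unfolding h_def using \<tau> ui by (intro set_lebesgue_integral_cong) (auto simp: set_integrable_rate_mult(2))
  also have "\<dots> = integral {0..t} (\<lambda>r. \<mu> * (LINT s:{0..}|lborel. u r s) + q r * (LINT s:{\<tau>..}|lborel. u r s))"
    using \<tau> by (intro continuous_set_integral_eq continuous_intros continuous_in_L1_integral[OF uc] q) auto
  finally show ?thesis .
qed

text \<open>
  At \<open>(t, s)\<close> the characteristic has spent time \<open>min t s\<close> in the quadrant, and it has been exposed to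
  promotion since time \<open>min t (max 0 (t - s + \<tau>))\<close>.
\<close>

definition damping :: "real \<Rightarrow> real \<Rightarrow> (real \<Rightarrow> real) \<Rightarrow> real \<Rightarrow> real \<Rightarrow> real" where
  "damping \<mu> \<tau> q t s =
     exp (- \<mu> * min t s - (integral {0..t} q - integral {0..min t (max 0 (t - s + \<tau>))} q))"

definition transport_solution ::
  "real \<Rightarrow> real \<Rightarrow> real \<Rightarrow> (real \<Rightarrow> real) \<Rightarrow> (real \<Rightarrow> real) \<Rightarrow> real \<Rightarrow> real \<Rightarrow> real" where
  "transport_solution \<mu> \<tau> b q f t s = (if s \<ge> t then f (s - t) else b) * damping \<mu> \<tau> q t s"

section \<open>The explicit solution of the linear problem\<close>

text \<open>For \<open>t < 0\<close> the interval is empty and the integral is 0, so continuity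
  extends to the whole line. Compositions with \<open>min\<close> and \<open>max\<close> in
  \<open>damping\<close> then need no side conditions.\<close>

lemma continuous_on_primitive:
  fixes q :: "real \<Rightarrow> real"
  assumes "continuous_on {0..} q"
  shows "continuous_on UNIV (\<lambda>t. integral {0..t} q)"
  unfolding continuous_on_eq_continuous_at[OF open_UNIV]
proof
  fix x :: real
  define T where "T = \<bar>x\<bar> + 1"
  let ?F = "\<lambda>t. integral {0..t} q"
  have "continuous_on {0..T} ?F"
    by (intro indefinite_integral_continuous_1 integrable_continuous_real continuous_on_subset[OF assms]) auto
  \<comment> \<open>Clamping the argument to \<open>{0..T}\<close> changes nothing below
    \<open>T\<close>, because the primitive vanishes at 0 and at all negative arguments.\<close>
  then have "continuous_on {..<T} (\<lambda>t. ?F (max 0 (min T t)))"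
    by (rule continuous_on_compose2) (auto intro!: continuous_intros simp: T_def)
  then have "continuous_on {..<T} ?F"
    by (rule continuous_on_eq) (auto simp: max_def)
  then show "isCont ?F x"
    by (simp add: continuous_on_eq_continuous_at T_def)
qed

lemma primitive_has_derivative:
  fixes q :: "real \<Rightarrow> real"
  assumes "continuous_on {0..} q" "r > 0"
  shows "((\<lambda>t. integral {0..t} q) has_real_derivative q r) (at r)"
proof -
  have "((\<lambda>t. integral {0..t} q) has_real_derivative q r) (at r within {0..r + 1})"
    using assms by (intro integral_has_real_derivative continuous_on_subset[OF assms(1)]) auto
  then show ?thesis using assms(2) by (simp add: at_within_Icc_at)
qed

lemma damping_0: "s \<ge> 0 \<Longrightarrow> damping \<mu> \<tau> q 0 s = 1"
  by (simp add: damping_def)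

lemma transport_solution_0: "s \<ge> 0 \<Longrightarrow> transport_solution \<mu> \<tau> b q f 0 s = f s"
  by (simp add: transport_solution_def damping_0)

text \<open>The case distinction becomes a sum of a translate of the datum extended by 0 and an
  indicator, the form on which integrability and continuity in time are proved.\<close>

lemma transport_solution_decomp:
  assumes "t \<ge> 0" "s \<ge> 0"
  shows "transport_solution \<mu> \<tau> b q f t s
    = (indicator {0..} (s - t) *\<^sub>R f (s - t) + b * indicator {0..<t} s) * damping \<mu> \<tau> q t s"
  using assms by (auto simp: transport_solution_def indicator_def)

lemma shifted_initial_integrable:
  fixes f :: "real \<Rightarrow> real"
  assumes f: "set_integrable lborel {0..} f"
  shows "integrable lborel (\<lambda>s. indicator {0..} (s - t) *\<^sub>R f (s - t))"
  using lborel_integrable_real_affine[OF f[unfolded set_integrable_def], of 1 "-t"] by simp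

context
  fixes \<mu> \<tau> :: real and q :: "real \<Rightarrow> real"
  assumes \<mu>: "\<mu> \<ge> 0" and \<tau>: "\<tau> \<ge> 0"
    and q: "continuous_on {0..} q" and q_nonneg: "\<And>t. t \<ge> 0 \<Longrightarrow> q t \<ge> 0"
begin

lemma damping_le:
  assumes "t \<ge> 0" "s \<ge> 0"
  shows "damping \<mu> \<tau> q t s \<le> exp (- \<mu> * min t s)"
proof -
  have "integral {0..min t (max 0 (t - s + \<tau>))} q \<le> integral {0..t} q"
    by (intro integral_subset_le integrable_continuous_real continuous_on_subset[OF q])
       (auto intro: q_nonneg)
  then show ?thesis by (simp add: damping_def)
qed

lemma damping_le_1:
  assumes "t \<ge> 0" "s \<ge> 0"
  shows "damping \<mu> \<tau> q t s \<le> 1"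
proof -
  have "exp (- \<mu> * min t s) \<le> 1" using \<mu> assms by simp
  then show ?thesis using damping_le[OF assms] by linarith
qed

lemma continuous_damping: "continuous_on UNIV (\<lambda>p. damping \<mu> \<tau> q (fst p) (snd p))"
  unfolding damping_def
  by (intro continuous_intros continuous_on_compose2[OF continuous_on_primitive[OF q]]) auto

lemma damping_measurable [measurable]: "(\<lambda>p. damping \<mu> \<tau> q (fst p) (snd p)) \<in> borel_measurable (borel \<Otimes>\<^sub>M borel)"
  unfolding borel_prod by (rule borel_measurable_continuous_onI[OF continuous_damping])

lemma damping_measurable2 [measurable]: "damping \<mu> \<tau> q t \<in> borel_measurable borel"
  using measurable_compose[OF _ damping_measurable, of "\<lambda>s. (t, s)" borel] by simp

text \<open>Here \<open>\<delta>\<close> is the time at which the characteristic has seniority 0,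
  and \<open>a\<close> its entry time into the quadrant. The damping equals 1 at entry and its
  derivative is minus the integrand, except at the single time when promotion sets in. The
  fundamental theorem of calculus tolerates this exceptional point.\<close>

lemma damping_characteristic:
  fixes \<delta> t :: real
  defines "a \<equiv> max 0 \<delta>"
  assumes t: "a \<le> t"
  shows "set_integrable lborel {a..t} (\<lambda>r. (\<mu> + q r * indicator {\<tau>..} (r - \<delta>)) * damping \<mu> \<tau> q r (r - \<delta>))"
    and "(LINT r:{a..t}|lborel. (\<mu> + q r * indicator {\<tau>..} (r - \<delta>)) * damping \<mu> \<tau> q r (r - \<delta>))
      = 1 - damping \<mu> \<tau> q t (t - \<delta>)"
proof -
  define F where "F = (\<lambda>t. integral {0..t} q)"
  \<comment> \<open>The onset of promotion on this characteristic: seniority reaches \<tau> at time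
    \<open>\<delta> + \<tau>\<close>, or has already done so at time 0.\<close>
  define c where "c = max 0 (\<delta> + \<tau>)"
  define G where "G = (\<lambda>r. exp (- \<mu> * (r - a) - (F r - F (min r c))))"
  have G: "damping \<mu> \<tau> q r (r - \<delta>) = G r" if "a \<le> r" for r
    using that by (auto simp: damping_def G_def F_def c_def a_def min_def max_def)
  have Fc: "continuous_on UNIV F" unfolding F_def by (rule continuous_on_primitive[OF q])
  have Gc: "continuous_on S G" for S
    unfolding G_def by (intro continuous_intros continuous_on_compose2[OF Fc]) auto
  have qc: "continuous_on {a..t} q" by (rule continuous_on_subset[OF q]) (auto simp: a_def)
  let ?k = "\<lambda>r. (\<mu> + q r * indicator {\<tau>..} (r - \<delta>)) * G r"
  have der: "(G has_vector_derivative - ?k r) (at r)" if r: "r \<in> {a<..<t} - {c}" for r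
  proof -
    have r0: "r > 0" using r by (auto simp: a_def)
    have "(G has_real_derivative - ?k r) (at r)"
    proof (cases "r < c")
      case True
      \<comment> \<open>As \<open>r > 0\<close>, the inequality \<open>r < c\<close> rules out
        \<open>c = 0\<close>, hence \<open>c = \<delta> + \<tau>\<close>.\<close>
      then have "r - \<delta> < \<tau>" using r0 by (auto simp: c_def)
      then have k: "- ?k r = - \<mu> * exp (- \<mu> * (r - a))" using True by (simp add: G_def)
      have "((\<lambda>r. exp (- \<mu> * (r - a))) has_real_derivative - ?k r) (at r)"
        unfolding k by (auto intro!: derivative_eq_intros)
      then show ?thesis
        by (rule has_field_derivative_transform_within_open[of _ _ _ "{..<c}"]) (use True in \<open>auto simp: G_def\<close>)
    next
      case False
      then have "r > c" using r by auto
      then have k: "- ?k r = (- \<mu> - q r) * exp (- \<mu> * (r - a) - (F r - F c))" 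
        by (simp add: G_def c_def algebra_simps)
      have "((\<lambda>r. exp (- \<mu> * (r - a) - (F r - F c))) has_real_derivative - ?k r) (at r)"
        unfolding k
        by (rule derivative_eq_intros primitive_has_derivative[OF q r0, folded F_def] refl | simp)+
      then show ?thesis
        by (rule has_field_derivative_transform_within_open[of _ _ _ "{c<..}"]) (use \<open>r > c\<close> in \<open>auto simp: G_def\<close>)
    qed
    then show ?thesis by (simp add: has_real_derivative_iff_has_vector_derivative)
  qed
  have Ga: "G a = 1" using \<tau> by (simp add: G_def a_def c_def min_absorb1)
  have "((\<lambda>r. - ?k r) has_integral G t - G a) {a..t}"
    by (rule fundamental_theorem_of_calculus_interior_strong[of "{c}"]) (use der t Gc in auto)
  then have hi: "(?k has_integral (1 - G t)) {a..t}"
    using has_integral_neg[of "\<lambda>r. - ?k r" "G t - G a" "{a..t}"] Ga by simp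
  have "set_integrable lborel {a..t} (\<lambda>r. \<mu> * G r)" "set_integrable lborel {a..t} (\<lambda>r. q r * G r)"
    by (intro borel_integrable_atLeastAtMost' continuous_intros Gc qc)+
  then have "set_integrable lborel {a..t} (\<lambda>r. \<mu> * G r)" "set_integrable lborel ({a..t} \<inter> {\<tau> + \<delta>..}) (\<lambda>r. q r * G r)"
    by (auto intro: set_integrable_subset)
  then have "integrable lborel (\<lambda>r. indicator {a..t} r *\<^sub>R (\<mu> * G r) + indicator ({a..t} \<inter> {\<tau> + \<delta>..}) r *\<^sub>R (q r * G r))"
    unfolding set_integrable_def by (rule Bochner_Integration.integrable_add)
  also have "(\<lambda>r. indicator {a..t} r *\<^sub>R (\<mu> * G r) + indicator ({a..t} \<inter> {\<tau> + \<delta>..}) r *\<^sub>R (q r * G r))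
    = (\<lambda>r. indicator {a..t} r *\<^sub>R ?k r)"
    by (auto simp: fun_eq_iff indicator_def algebra_simps)
  finally have si: "set_integrable lborel {a..t} ?k" unfolding set_integrable_def .
  show "set_integrable lborel {a..t} (\<lambda>r. (\<mu> + q r * indicator {\<tau>..} (r - \<delta>)) * damping \<mu> \<tau> q r (r - \<delta>))"
    using si by (subst set_integrable_cong[OF refl refl, of _ _ ?k]) (auto simp: G)
  have "(LINT r:{a..t}|lborel. (\<mu> + q r * indicator {\<tau>..} (r - \<delta>)) * damping \<mu> \<tau> q r (r - \<delta>))
      = (LINT r:{a..t}|lborel. ?k r)"
    by (rule set_lebesgue_integral_cong) (auto simp: G)
  also have "\<dots> = 1 - G t"
    using set_borel_integral_eq_integral(2)[OF si] integral_unique[OF hi] by simp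
  finally show "(LINT r:{a..t}|lborel. (\<mu> + q r * indicator {\<tau>..} (r - \<delta>)) * damping \<mu> \<tau> q r (r - \<delta>))
      = 1 - damping \<mu> \<tau> q t (t - \<delta>)" using G[OF t] by simp
qed

context
  fixes b :: real and f :: "real \<Rightarrow> real"
  assumes f: "set_integrable lborel {0..} f"
begin

lemma transport_solution_integrable:
  assumes t: "t \<ge> 0"
  shows "set_integrable lborel {0..} (transport_solution \<mu> \<tau> b q f t)"
proof -
  let ?g = "\<lambda>s. indicator {0..} (s - t) *\<^sub>R f (s - t) + b * indicator {0..<t} s"
  have g: "integrable lborel ?g"
    using shifted_initial_integrable[OF f, of t] t
    by (intro Bochner_Integration.integrable_add integrable_mult_right) (auto simp: integrable_indicator_iff)
  have "integrable lborel (\<lambda>s. indicator {0..} s *\<^sub>R (?g s * damping \<mu> \<tau> q t s))"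
  proof (rule Bochner_Integration.integrable_bound[OF g])
    show "(\<lambda>s. indicator {0..} s *\<^sub>R (?g s * damping \<mu> \<tau> q t s)) \<in> borel_measurable lborel"
      using borel_measurable_integrable[OF g] by measurable
    show "AE s in lborel. norm (indicator {0..} s *\<^sub>R (?g s * damping \<mu> \<tau> q t s)) \<le> norm (?g s)"
    proof (intro AE_I2)
      fix s
      show "norm (indicator {0..} s *\<^sub>R (?g s * damping \<mu> \<tau> q t s)) \<le> norm (?g s)"
        using damping_le_1[OF t, of s] mult_left_mono[of "\<bar>damping \<mu> \<tau> q t s\<bar>" 1 "\<bar>?g s\<bar>"]
        by (auto simp: indicator_def abs_mult damping_def)
    qed
  qed
  also have "(\<lambda>s. indicator {0..} s *\<^sub>R (?g s * damping \<mu> \<tau> q t s))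
    = (\<lambda>s. indicator {0..} s *\<^sub>R transport_solution \<mu> \<tau> b q f t s)"
    using transport_solution_decomp[OF t] by (auto simp: fun_eq_iff split: split_indicator)
  finally show ?thesis unfolding set_integrable_def .
qed

text \<open>The increment in time splits into the translation error of the datum, handled by
  \<open>translation_L1\<close>, and a remainder \<open>e\<close> with the datum frozen at its
  position at time \<open>t\<close>. The remainder tends to 0 by dominated convergence.\<close>

lemma transport_solution_continuous_in_L1: "continuous_in_L1 (transport_solution \<mu> \<tau> b q f)"
  unfolding continuous_in_L1_def
proof (intro conjI allI impI transport_solution_integrable)
  fix t :: real assume t: "t \<ge> 0"
  let ?u = "transport_solution \<mu> \<tau> b q f"
  let ?D = "damping \<mu> \<tau> q"
  define f0 where "f0 = (\<lambda>s. indicator {0..} s *\<^sub>R f s)"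
  have f0: "integrable lborel (\<lambda>s. f0 (s - r))" for r
    unfolding f0_def by (rule shifted_initial_integrable[OF f])
  have [measurable]: "f0 \<in> borel_measurable borel" using f0[of 0] by auto
  show "((\<lambda>t'. LINT s:{0..}|lborel. \<bar>?u t' s - ?u t s\<bar>) \<longlongrightarrow> 0) (at t within {0..})"
    unfolding tendsto_at_iff_sequentially comp_def
  proof (intro allI impI)
    fix X :: "nat \<Rightarrow> real" assume X: "\<forall>i. X i \<in> {0..} - {t}" and lim: "X \<longlonglongrightarrow> t"
    have X0: "X i \<ge> 0" for i using X by auto
    \<comment> \<open>A convergent sequence is bounded, which gives the indicators of
      \<open>{0..<X n}\<close> a common integrable majorant.\<close>
    obtain M where M: "\<And>n. X n \<le> M"
      using convergent_imp_Bseq[of X] lim unfolding convergent_def Bseq_def by (auto simp: abs_le_iff)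
    define e where "e = (\<lambda>n s. indicator {0..} s * (\<bar>f0 (s - t)\<bar> * \<bar>?D (X n) s - ?D t s\<bar>
      + \<bar>b\<bar> * \<bar>indicator {0..<X n} s * ?D (X n) s - indicator {0..<t} s * ?D t s\<bar>))"
    define W where "W = (\<lambda>s. \<bar>f0 (s - t)\<bar> * 2 + \<bar>b\<bar> * (2 * indicator {0..max M t} s))"
    have W: "integrable lborel W"
      unfolding W_def using f0[of t]
      by (intro Bochner_Integration.integrable_add integrable_mult_right integrable_mult_left integrable_abs)
         (auto simp: integrable_indicator_iff emeasure_lborel_Icc_eq)
    have e_meas: "e n \<in> borel_measurable lborel" for n unfolding e_def by measurable
    have e_le: "norm (e n s) \<le> W s" for n s
    proof (cases "s \<ge> 0")
      case True
      have D: "\<bar>?D (X n) s\<bar> \<le> 1" "\<bar>?D t s\<bar> \<le> 1"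
        using damping_le_1[OF X0 True] damping_le_1[OF t True] by (auto simp: damping_def)
      have "\<bar>?D (X n) s - ?D t s\<bar> \<le> 2" using D by linarith
      moreover have "\<bar>indicator {0..<X n} s * ?D (X n) s - indicator {0..<t} s * ?D t s\<bar> \<le> 2 * indicator {0..max M t} s"
        using D M[of n] by (auto simp: indicator_def)
      ultimately have "\<bar>f0 (s - t)\<bar> * \<bar>?D (X n) s - ?D t s\<bar>
          + \<bar>b\<bar> * \<bar>indicator {0..<X n} s * ?D (X n) s - indicator {0..<t} s * ?D t s\<bar> \<le> W s"
        unfolding W_def by (intro add_mono mult_left_mono) auto
      then show ?thesis using True by (simp add: e_def)
    qed (simp add: e_def W_def)
    have e_int: "integrable lborel (e n)" for n
      by (rule Bochner_Integration.integrable_bound[OF W e_meas]) (use e_le in \<open>auto intro: order_trans[OF _ abs_ge_self]\<close>)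
    \<comment> \<open>Only at \<open>s = t\<close> can the indicator of \<open>{0..<X n}\<close>
      fail to settle, and a single point is negligible.\<close>
    have e_pt: "(\<lambda>n. e n s) \<longlonglongrightarrow> 0" if "s \<noteq> t" for s
    proof -
      have Dl: "(\<lambda>n. ?D (X n) s) \<longlonglongrightarrow> ?D t s"
        using continuous_on_tendsto_compose[OF continuous_damping, of "\<lambda>n. (X n, s)" "(t, s)" sequentially]
          tendsto_Pair[OF lim tendsto_const[of s]] by simp
      have "eventually (\<lambda>n. indicator {0..<X n} s = (indicator {0..<t} s :: real)) sequentially"
      proof (cases "s < t")
        case True
        from order_tendstoD(1)[OF lim this] show ?thesis
          by eventually_elim (use True in \<open>auto simp: indicator_def\<close>)
      next
        case False
        then have "t < s" using that by simp
        from order_tendstoD(2)[OF lim this] show ?thesis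
          by eventually_elim (use \<open>t < s\<close> in \<open>auto simp: indicator_def\<close>)
      qed
      then have il: "(\<lambda>n. indicator {0..<X n} s) \<longlonglongrightarrow> (indicator {0..<t} s :: real)"
        by (rule tendsto_eventually)
      have "(\<lambda>n. e n s) \<longlonglongrightarrow> indicator {0..} s * (\<bar>f0 (s - t)\<bar> * \<bar>?D t s - ?D t s\<bar>
      + \<bar>b\<bar> * \<bar>indicator {0..<t} s * ?D t s - indicator {0..<t} s * ?D t s\<bar>)"
        unfolding e_def by (intro tendsto_intros Dl il)
      then show ?thesis by simp
    qed
    have e_lim: "(\<lambda>n. LINT s|lborel. e n s) \<longlonglongrightarrow> (LINT s::real|lborel. (0::real))"
    proof (rule integral_dominated_convergence[OF _ e_meas W])
      show "AE s in lborel. (\<lambda>n. e n s) \<longlonglongrightarrow> 0"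
        using AE_lborel_singleton[of t] by eventually_elim (rule e_pt)
    qed (use e_le in auto)
    have tr: "(\<lambda>n. LINT s|lborel. \<bar>f0 (s - X n) - f0 (s - t)\<bar>) \<longlonglongrightarrow> 0"
      using translation_L1[OF f0[of t], of "\<lambda>n. X n - t"] lim by (simp add: LIM_zero algebra_simps)
    have le: "norm (LINT s:{0..}|lborel. \<bar>?u (X n) s - ?u t s\<bar>)
        \<le> (LINT s|lborel. \<bar>f0 (s - X n) - f0 (s - t)\<bar>) + (LINT s|lborel. e n s)" for n
    proof -
      have i: "integrable lborel (\<lambda>s. \<bar>f0 (s - X n) - f0 (s - t)\<bar>)" using f0 by simp
      have i': "set_integrable lborel {0..} (\<lambda>s. \<bar>?u (X n) s - ?u t s\<bar>)"
        by (intro set_integrable_abs set_integral_diff transport_solution_integrable X0 t)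
      have "norm (LINT s:{0..}|lborel. \<bar>?u (X n) s - ?u t s\<bar>) = (LINT s:{0..}|lborel. \<bar>?u (X n) s - ?u t s\<bar>)"
        by (simp add: set_lebesgue_integral_def)
      also have "\<dots> \<le> (LINT s|lborel. \<bar>f0 (s - X n) - f0 (s - t)\<bar> + e n s)"
        unfolding set_lebesgue_integral_def
      proof (intro integral_mono i'[unfolded set_integrable_def] Bochner_Integration.integrable_add i e_int)
        fix s :: real
        show "indicator {0..} s *\<^sub>R \<bar>?u (X n) s - ?u t s\<bar> \<le> \<bar>f0 (s - X n) - f0 (s - t)\<bar> + e n s"
        proof (cases "s \<ge> 0")
          case True
          have D: "0 \<le> ?D (X n) s" "?D (X n) s \<le> 1"
            using damping_le_1[OF X0 True] by (auto simp: damping_def)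
          have "?u (X n) s - ?u t s = (f0 (s - X n) - f0 (s - t)) * ?D (X n) s
              + f0 (s - t) * (?D (X n) s - ?D t s)
              + b * (indicator {0..<X n} s * ?D (X n) s - indicator {0..<t} s * ?D t s)"
            using transport_solution_decomp[OF X0 True] transport_solution_decomp[OF t True]
            unfolding f0_def by (simp add: algebra_simps)
          then have "\<bar>?u (X n) s - ?u t s\<bar> \<le> \<bar>(f0 (s - X n) - f0 (s - t)) * ?D (X n) s\<bar>
              + \<bar>f0 (s - t) * (?D (X n) s - ?D t s)\<bar>
              + \<bar>b * (indicator {0..<X n} s * ?D (X n) s - indicator {0..<t} s * ?D t s)\<bar>"
            by linarith
          also have "\<dots> = \<bar>f0 (s - X n) - f0 (s - t)\<bar> * ?D (X n) s + e n s"
            using True D by (simp add: e_def abs_mult)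
          also have "\<dots> \<le> \<bar>f0 (s - X n) - f0 (s - t)\<bar> * 1 + e n s"
            using D by (intro add_right_mono mult_left_mono) auto
          finally show ?thesis using True by simp
        qed (simp add: e_def)
      qed
      also have "\<dots> = (LINT s|lborel. \<bar>f0 (s - X n) - f0 (s - t)\<bar>) + (LINT s|lborel. e n s)"
        using i e_int by (rule Bochner_Integration.integral_add)
      finally show ?thesis .
    qed
    have "(\<lambda>n. (LINT s|lborel. \<bar>f0 (s - X n) - f0 (s - t)\<bar>) + (LINT s|lborel. e n s)) \<longlonglongrightarrow> 0"
      using tendsto_add_zero[OF tr] e_lim by simp
    then show "(\<lambda>n. LINT s:{0..}|lborel. \<bar>?u (X n) s - ?u t s\<bar>) \<longlonglongrightarrow> 0"
      by (rule Lim_null_comparison[OF always_eventually[OF allI[OF le]]])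
  qed
qed

lemma transport_solution_measurable:
  "set_borel_measurable borel ({0..} \<times> {0..}) (\<lambda>(t, s). transport_solution \<mu> \<tau> b q f t s)"
proof -
  define f0 where "f0 = (\<lambda>s. indicator {0..} s *\<^sub>R f s)"
  have [measurable]: "f0 \<in> borel_measurable borel"
    using f unfolding f0_def set_integrable_def by auto
  have "(\<lambda>p. indicator ({0..} \<times> {0..}) p *\<^sub>R (case p of (t, s) \<Rightarrow> transport_solution \<mu> \<tau> b q f t s))
    = (\<lambda>p. indicator ({0..} \<times> {0..}) p *\<^sub>R ((f0 (snd p - fst p) + b * (if 0 \<le> snd p \<and> snd p < fst p then 1 else 0))
        * damping \<mu> \<tau> q (fst p) (snd p)))"
    by (auto simp: fun_eq_iff transport_solution_def f0_def split: split_indicator)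
  also have "\<dots> \<in> borel_measurable (borel \<Otimes>\<^sub>M borel)" by measurable
  finally show ?thesis unfolding set_borel_measurable_def borel_prod .
qed

text \<open>On each characteristic the candidate is a constant times the damping, so the equation is
  that constant times \<open>damping_characteristic\<close>.\<close>

lemma mild_solution_transport_solution: "mild_solution \<mu> \<tau> b q (transport_solution \<mu> \<tau> b q f)"
  unfolding mild_solution_def
proof (intro conjI allI impI AE_I2 transport_solution_measurable transport_solution_continuous_in_L1)
  fix t s :: real assume t: "t \<ge> 0" and s: "s \<ge> 0"
  define u0 where "u0 = (if s \<ge> t then f (s - t) else b)"
  have at: "max 0 (t - s) \<le> t" using t s by simp
  \<comment> \<open>Since \<open>s - t + r \<ge> r\<close> is equivalent to
    \<open>s \<ge> t\<close>, the branch taken in \<open>transport_solution\<close> does not change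
    along the characteristic.\<close>
  have eq: "(\<mu> + q r * indicator {\<tau>..} (s - t + r)) * transport_solution \<mu> \<tau> b q f r (s - t + r)
     = u0 * ((\<mu> + q r * indicator {\<tau>..} (r - (t - s))) * damping \<mu> \<tau> q r (r - (t - s)))" for r
    by (auto simp: transport_solution_def u0_def algebra_simps)
  note D = damping_characteristic[of "t - s" t, OF at]
  show "set_integrable lborel {max 0 (t - s)..t}
     (\<lambda>r. (\<mu> + q r * indicator {\<tau>..} (s - t + r)) * transport_solution \<mu> \<tau> b q f r (s - t + r))"
    unfolding eq using D(1) by (rule set_integrable_mult_right)
  show "transport_solution \<mu> \<tau> b q f t s = (if t \<le> s then transport_solution \<mu> \<tau> b q f 0 (s - t) else b)
     - (LINT r:{max 0 (t - s)..t}|lborel.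
          (\<mu> + q r * indicator {\<tau>..} (s - t + r)) * transport_solution \<mu> \<tau> b q f r (s - t + r))"
    unfolding eq set_integral_mult_right D(2)
    using transport_solution_0[of "s - t"]
    by (auto simp: transport_solution_def[of _ _ _ _ _ t] u0_def algebra_simps)
qed

end

end

section \<open>Elementary integrals, change of representative, conservation of mass\<close>

lemma set_integral_atLeastLessThan_eq_Icc:
  fixes g :: "real \<Rightarrow> real"
  shows "(LINT s:{a..<t}|lborel. g s) = (LINT s:{a..t}|lborel. g s)"
  by (rule set_integral_discrete_difference[where X = "{t}"]) auto

lemma set_integral_exp:
  fixes \<mu> t :: real
  assumes "\<mu> \<noteq> 0" "t \<ge> 0"
  shows "(LINT s:{0..<t}|lborel. exp (- \<mu> * s)) = (1 - exp (- \<mu> * t)) / \<mu>"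
proof -
  have "((\<lambda>s. exp (- \<mu> * s)) has_integral (- exp (- \<mu> * t) / \<mu>) - (- exp (- \<mu> * 0) / \<mu>)) {0..t}"
    using assms
    by (intro fundamental_theorem_of_calculus)
       (auto simp: has_real_derivative_iff_has_vector_derivative[symmetric] intro!: derivative_eq_intros)
  moreover have "(LINT s:{0..t}|lborel. exp (- \<mu> * s)) = integral {0..t} (\<lambda>s. exp (- \<mu> * s))"
    by (intro set_borel_integral_eq_integral borel_integrable_atLeastAtMost' continuous_intros)
  ultimately show ?thesis
    unfolding set_integral_atLeastLessThan_eq_Icc by (simp add: integral_unique diff_divide_distrib)
qed

lemma set_integrable_exp_Ici:
  fixes \<mu> :: real
  assumes "\<mu> > 0"
  shows "set_integrable lborel {0..} (\<lambda>s. exp (- \<mu> * s))"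
proof -
  have "(\<lambda>s. exp (- \<mu> * s)) absolutely_integrable_on {0..}"
    using integrable_on_exp_minus_to_infinity[OF assms, of 0]
    by (intro nonnegative_absolutely_integrable_1) (auto simp: mult.commute)
  then show ?thesis
    unfolding set_integrable_def by (subst (asm) integrable_completion) auto
qed

lemma set_integral_split_at:
  fixes g :: "real \<Rightarrow> real"
  assumes "set_integrable lborel {0..} g" "\<tau> \<ge> 0"
  shows "(LINT s:{0..}|lborel. g s) = (LINT s:{0..<\<tau>}|lborel. g s) + (LINT s:{\<tau>..}|lborel. g s)"
proof -
  have "{0..} = {0..<\<tau>} \<union> {\<tau>..}" using assms(2) by auto
  moreover have "set_integrable lborel {0..<\<tau>} g" "set_integrable lborel {\<tau>..} g"
    using assms by (auto intro: set_integrable_subset)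
  ultimately show ?thesis
    using set_integral_Un[of "{0..<\<tau>}" "{\<tau>..}" lborel g] by (simp add: ivl_disj_int)
qed

lemma set_integral_cong_AE_Ici:
  fixes g h :: "real \<Rightarrow> real"
  assumes "set_integrable lborel {0..} g" "set_integrable lborel {0..} h"
    and AE: "AE s in lborel. s \<ge> 0 \<longrightarrow> g s = h s" and A: "A \<in> sets borel" "A \<subseteq> {0..}"
  shows "(LINT s:A|lborel. g s) = (LINT s:A|lborel. h s)"
proof (rule set_lebesgue_integral_cong_AE_on)
  have "set_integrable lborel A g" "set_integrable lborel A h"
    using assms by (auto intro: set_integrable_subset)
  then show "set_borel_measurable lborel A g" "set_borel_measurable lborel A h"
    by (auto simp: set_integrable_def set_borel_measurable_def)
  show "AE x in lborel. x \<in> A \<longrightarrow> g x = h x" using AE by eventually_elim (use A in auto)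
qed

lemma mild_solution_cong:
  assumes "mild_solution \<mu> \<tau> b q u"
    and q: "\<And>t. t \<ge> 0 \<Longrightarrow> q t = q' t" and u: "\<And>t s. t \<ge> 0 \<Longrightarrow> s \<ge> 0 \<Longrightarrow> u t s = u' t s"
  shows "mild_solution \<mu> \<tau> b q' u'"
proof -
  have 1: "set_borel_measurable borel ({0..} \<times> {0..}) (\<lambda>(t, s). u' t s)"
  proof -
    have "(\<lambda>p. indicator ({0..} \<times> {0..}) p *\<^sub>R (case p of (t, s) \<Rightarrow> u' t s))
      = (\<lambda>p. indicator ({0..} \<times> {0..}) p *\<^sub>R (case p of (t, s) \<Rightarrow> u t s))"
      using u by (auto simp: fun_eq_iff indicator_def)
    then show ?thesis using assms(1) unfolding mild_solution_def set_borel_measurable_def by simp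
  qed
  have 2: "continuous_in_L1 u'"
    unfolding continuous_in_L1_def
  proof (intro conjI allI impI)
    fix t :: real assume t: "t \<ge> 0"
    have uc: "continuous_in_L1 u" using assms(1) by (simp add: mild_solution_def)
    then have "set_integrable lborel {0..} (u t)" using t by (simp add: continuous_in_L1_def)
    then show "set_integrable lborel {0..} (u' t)"
      by (subst set_integrable_cong[OF refl refl, of _ _ "u t"]) (use u t in auto)
    have eq: "(LINT s:{0..}|lborel. \<bar>u t' s - u t s\<bar>) = (LINT s:{0..}|lborel. \<bar>u' t' s - u' t s\<bar>)"
      if "t' \<ge> 0" for t'
      using u t that by (intro set_lebesgue_integral_cong) auto
    have "((\<lambda>t'. LINT s:{0..}|lborel. \<bar>u t' s - u t s\<bar>) \<longlongrightarrow> 0) (at t within {0..})"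
      using uc t by (simp add: continuous_in_L1_def)
    then show "((\<lambda>t'. LINT s:{0..}|lborel. \<bar>u' t' s - u' t s\<bar>) \<longlongrightarrow> 0) (at t within {0..})"
      by (rule Lim_transform_eventually) (auto simp: eventually_at_filter eq)
  qed
  have 3: "AE s in lborel. s \<ge> 0 \<longrightarrow>
        set_integrable lborel {max 0 (t - s)..t}
          (\<lambda>r. (\<mu> + q' r * indicator {\<tau>..} (s - t + r)) * u' r (s - t + r)) \<and>
        u' t s = (if s \<ge> t then u' 0 (s - t) else b)
          - (LINT r:{max 0 (t - s)..t}|lborel.
               (\<mu> + q' r * indicator {\<tau>..} (s - t + r)) * u' r (s - t + r))"
    if t: "t \<ge> 0" for t
  proof -
    have "AE s in lborel. s \<ge> 0 \<longrightarrow>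
        set_integrable lborel {max 0 (t - s)..t}
          (\<lambda>r. (\<mu> + q r * indicator {\<tau>..} (s - t + r)) * u r (s - t + r)) \<and>
        u t s = (if s \<ge> t then u 0 (s - t) else b)
          - (LINT r:{max 0 (t - s)..t}|lborel.
               (\<mu> + q r * indicator {\<tau>..} (s - t + r)) * u r (s - t + r))"
      using assms(1) t by (simp add: mild_solution_def)
    then show ?thesis
    proof eventually_elim
      case (elim s)
      let ?g = "\<lambda>q u r. (\<mu> + q r * indicator {\<tau>..} (s - t + r)) * u r (s - t + r) :: real"
      have eq: "?g q u r = ?g q' u' r" if "r \<in> {max 0 (t - s)..t}" for r
        using q[of r] u[of r "s - t + r"] that by auto
      have "set_integrable lborel {max 0 (t - s)..t} (?g q u) = set_integrable lborel {max 0 (t - s)..t} (?g q' u')"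
        by (intro set_integrable_cong eq refl)
      moreover have "(LINT r:{max 0 (t - s)..t}|lborel. ?g q u r) = (LINT r:{max 0 (t - s)..t}|lborel. ?g q' u' r)"
        by (intro set_lebesgue_integral_cong) (use eq in auto)
      moreover have "u t s = u' t s" "t \<le> s \<longrightarrow> u 0 (s - t) = u' 0 (s - t)" if "s \<ge> 0" using u t that by auto
      ultimately show ?case using elim by (auto split: if_splits)
    qed
  qed
  show ?thesis using 1 2 3 unfolding mild_solution_def by blast
qed

text \<open>
  For a solution of the nonlinear problem \<open>p = 0\<close>. In the construction of a solution, where it is not
  yet known that \<open>q\<close> is the promotion rate of \<open>u\<close> itself, \<open>p = q\<close>.
\<close>

lemma mass_conserved:
  assumes u: "mild_solution \<mu> \<tau> b q u" and \<tau>: "\<tau> \<ge> 0" and \<mu>: "\<mu> \<ge> 0"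
    and q: "continuous_on {0..} q" and p: "continuous_on {0..} p"
    and b: "b = c + \<mu> * N" and init: "(LINT s:{0..}|lborel. u 0 s) = N"
    and flux: "\<And>r. r \<ge> 0 \<Longrightarrow>
      q r * (LINT s:{\<tau>..}|lborel. u r s) = c + p r * ((LINT s:{0..}|lborel. u r s) - N)"
    and t: "t \<ge> 0"
  shows "(LINT s:{0..}|lborel. u t s) = N"
proof -
  have uc: "continuous_in_L1 u" using u by (simp add: mild_solution_def)
  define T where "T = t"
  define d where "d = (\<lambda>t. (LINT s:{0..}|lborel. u t s) - N)"
  have dc: "continuous_on {0..} d"
    unfolding d_def by (intro continuous_intros continuous_in_L1_integral[OF uc]) auto
  obtain Kp where Kp: "Kp \<ge> 0" "\<And>r. r \<in> {0..T} \<Longrightarrow> \<bar>p r\<bar> \<le> Kp" using continuous_on_Icc_bound[OF p] by blast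
  define K where "K = \<mu> + Kp"
  have "\<bar>d T\<bar> = 0"
  proof (rule gronwall_zero[where f = "\<lambda>t. \<bar>d t\<bar>" and K = K and T = T])
    show "continuous_on {0..T} (\<lambda>t. \<bar>d t\<bar>)"
      by (intro continuous_intros continuous_on_subset[OF dc]) auto
    fix t assume tT: "t \<in> {0..T}"
    then have t: "t \<ge> 0" by simp
    have c: "continuous_on {0..t} (\<lambda>r. (\<mu> + p r) * d r)" "continuous_on {0..t} d"
      "continuous_on {0..t} p"
      by (auto intro!: continuous_intros continuous_on_subset[OF dc] continuous_on_subset[OF p])
    have "d t = b * t - integral {0..t} (\<lambda>r. \<mu> * (LINT s:{0..}|lborel. u r s) + q r * (LINT s:{\<tau>..}|lborel. u r s))"
      using mild_solution_mass[OF u q \<tau> t] init by (simp add: d_def)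
    \<comment> \<open>With \<open>M = N + d\<close>, the hypotheses \<open>flux\<close> and
      \<open>b\<close> turn the total loss \<open>\<mu> M + q A\<close> into
      \<open>b + (\<mu> + p) d\<close>; its constant part cancels against the recruitment
      \<open>b * t\<close>.\<close>
    also have "integral {0..t} (\<lambda>r. \<mu> * (LINT s:{0..}|lborel. u r s) + q r * (LINT s:{\<tau>..}|lborel. u r s))
       = integral {0..t} (\<lambda>r. b + (\<mu> + p r) * d r)"
      by (rule Henstock_Kurzweil_Integration.integral_cong) (auto simp: flux b d_def algebra_simps)
    also have "\<dots> = integral {0..t} (\<lambda>r. b) + integral {0..t} (\<lambda>r. (\<mu> + p r) * d r)"
      using c by (intro Henstock_Kurzweil_Integration.integral_add integrable_continuous_real continuous_intros)
    finally have dt: "d t = - integral {0..t} (\<lambda>r. (\<mu> + p r) * d r)" using t by (simp add: mult.commute)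
    have "\<bar>d t\<bar> \<le> integral {0..t} (\<lambda>r. K * \<bar>d r\<bar>)"
    proof -
      have "norm (integral {0..t} (\<lambda>r. (\<mu> + p r) * d r)) \<le> integral {0..t} (\<lambda>r. K * \<bar>d r\<bar>)"
      proof (rule integral_norm_bound_integral)
        fix r assume "r \<in> {0..t}"
        then have "\<bar>\<mu> + p r\<bar> \<le> K" using Kp(2)[of r] tT \<mu> by (auto simp: K_def)
        then show "norm ((\<mu> + p r) * d r) \<le> K * \<bar>d r\<bar>" by (simp add: abs_mult mult_right_mono)
      qed (use c in \<open>auto intro!: integrable_continuous_real continuous_intros\<close>)
      then show ?thesis using dt by simp
    qed
    then show "\<bar>d t\<bar> \<le> K * integral {0..t} (\<lambda>t. \<bar>d t\<bar>)" by simp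
  qed (use Kp \<mu> t in \<open>auto simp: K_def T_def\<close>)
  then show ?thesis by (simp add: d_def T_def)
qed

subsection \<open>A single job level\<close>

text \<open>
  The mass of seniority less than \<open>\<tau>\<close>, on which the promotion rate has no influence.
\<close>

definition young_mass :: "real \<Rightarrow> real \<Rightarrow> real \<Rightarrow> (real \<Rightarrow> real) \<Rightarrow> real \<Rightarrow> real" where
  "young_mass \<mu> \<tau> b f t =
     (LINT s:{0..<\<tau>}|lborel. (if s \<ge> t then f (s - t) else b) * exp (- \<mu> * min t s))"

lemma damping_young: "s < \<tau> \<Longrightarrow> t \<ge> 0 \<Longrightarrow> damping \<mu> \<tau> q t s = exp (- \<mu> * min t s)"
  by (simp add: damping_def min_absorb1)

lemma young_mass_transport_solution:
  assumes "t \<ge> 0"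
  shows "(LINT s:{0..<\<tau>}|lborel. transport_solution \<mu> \<tau> b q f t s) = young_mass \<mu> \<tau> b f t"
  unfolding young_mass_def using assms
  by (intro set_lebesgue_integral_cong) (auto simp: transport_solution_def damping_young)

text \<open>The rate has no influence below \<tau>, so it may be taken as 0: the young mass is then
  a partial integral of an L1-continuous curve.\<close>

lemma continuous_on_young_mass:
  assumes "\<mu> \<ge> 0" "\<tau> \<ge> 0" "set_integrable lborel {0..} f"
  shows "continuous_on {0..} (young_mass \<mu> \<tau> b f)"
proof -
  have "continuous_on {0..} (\<lambda>t. LINT s:{0..<\<tau>}|lborel. transport_solution \<mu> \<tau> b (\<lambda>_. 0) f t s)"
    using assms by (intro continuous_in_L1_integral transport_solution_continuous_in_L1) auto
  then show ?thesis
    by (rule continuous_on_eq) (simp add: young_mass_transport_solution)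
qed

text \<open>From time \<tau> on, everybody of seniority below \<tau> was recruited through the
  boundary after time 0, and the datum \<open>f\<close> has dropped out.\<close>

lemma young_mass_late:
  assumes "\<mu> > 0" "\<tau> \<ge> 0" "t \<ge> \<tau>"
  shows "young_mass \<mu> \<tau> b f t = b * (1 - exp (- \<mu> * \<tau>)) / \<mu>"
proof -
  have "young_mass \<mu> \<tau> b f t = (LINT s:{0..<\<tau>}|lborel. b * exp (- \<mu> * s))"
    unfolding young_mass_def using assms by (intro set_lebesgue_integral_cong) auto
  also have "\<dots> = b * ((1 - exp (- \<mu> * \<tau>)) / \<mu>)"
    unfolding set_integral_mult_right using assms by (subst set_integral_exp) auto
  finally show ?thesis by simp
qed

text \<open>This brings the young mass into the form of the smallness hypothesis of the theorem: the
  initial workers who are still young, thinned by turnover, plus the recruits since time 0.\<close>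

lemma young_mass_early:
  assumes "\<mu> > 0" "0 \<le> t" "t \<le> \<tau>" "set_integrable lborel {0..} f"
  shows "young_mass \<mu> \<tau> b f t
    = exp (- t * \<mu>) * (LINT s:{t..\<tau>}|lborel. f (s - t)) + 1 / \<mu> * (1 - exp (- \<mu> * t)) * b"
proof -
  let ?g = "\<lambda>s. (if s \<ge> t then f (s - t) else b) * exp (- \<mu> * min t s)"
  have "set_integrable lborel {t..} (\<lambda>s. f (s - t))"
    using shifted_initial_integrable[OF assms(4), of t]
    by (simp add: set_integrable_def indicator_def)
  then have f: "set_integrable lborel {t..<\<tau>} (\<lambda>s. f (s - t))"
    by (rule set_integrable_subset) auto
  have g2: "set_integrable lborel {t..<\<tau>} ?g"
    by (subst set_integrable_cong[OF refl refl, of _ _ "\<lambda>s. f (s - t) * exp (- \<mu> * t)"])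
       (use f in \<open>auto intro: set_integrable_mult_left\<close>)
  have "set_integrable lborel {0..t} (\<lambda>s. b * exp (- \<mu> * s))"
    by (intro borel_integrable_atLeastAtMost' continuous_intros)
  then have "set_integrable lborel {0..<t} (\<lambda>s. b * exp (- \<mu> * s))"
    by (rule set_integrable_subset) auto
  then have g1: "set_integrable lborel {0..<t} ?g"
    by (subst set_integrable_cong[OF refl refl, of _ _ "\<lambda>s. b * exp (- \<mu> * s)"]) auto
  have "{0..<\<tau>} = {0..<t} \<union> {t..<\<tau>}" using assms by auto
  then have "young_mass \<mu> \<tau> b f t = (LINT s:{0..<t}|lborel. ?g s) + (LINT s:{t..<\<tau>}|lborel. ?g s)"
    unfolding young_mass_def using set_integral_Un[OF _ g1 g2] by simp
  also have "(LINT s:{0..<t}|lborel. ?g s) = (LINT s:{0..<t}|lborel. b * exp (- \<mu> * s))"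
    by (intro set_lebesgue_integral_cong) auto
  also have "\<dots> = b * ((1 - exp (- \<mu> * t)) / \<mu>)"
    unfolding set_integral_mult_right using assms by (subst set_integral_exp) auto
  also have "(LINT s:{t..<\<tau>}|lborel. ?g s) = (LINT s:{t..<\<tau>}|lborel. exp (- t * \<mu>) * f (s - t))"
    by (intro set_lebesgue_integral_cong) (auto simp: mult.commute)
  also have "\<dots> = exp (- t * \<mu>) * (LINT s:{t..\<tau>}|lborel. f (s - t))"
    unfolding set_integral_mult_right set_integral_atLeastLessThan_eq_Icc ..
  finally show ?thesis by simp
qed

text \<open>
  The case \<open>c = 0\<close> is the top level, where no positivity is required.
\<close>

definition level_solution ::
  "real \<Rightarrow> real \<Rightarrow> real \<Rightarrow> real \<Rightarrow> (real \<Rightarrow> real \<Rightarrow> real) \<Rightarrow> bool" where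
  "level_solution \<mu> \<tau> b c u \<longleftrightarrow>
     mild_solution \<mu> \<tau> b (\<lambda>t. c / (LINT s:{\<tau>..}|lborel. u t s)) u \<and>
     (c = 0 \<or> (\<forall>t\<ge>0. (LINT s:{\<tau>..}|lborel. u t s) > 0))"

text \<open>The denominator is \<open>A\<close> under the assumption that the total mass is
  \<open>N\<close>. The rate thus depends on the datum alone and is available before any solution
  is.\<close>

definition promotion_rate ::
  "real \<Rightarrow> real \<Rightarrow> real \<Rightarrow> real \<Rightarrow> real \<Rightarrow> (real \<Rightarrow> real) \<Rightarrow> real \<Rightarrow> real" where
  "promotion_rate \<mu> \<tau> N b c f t = c / (N - young_mass \<mu> \<tau> b f t)"

text \<open>One formula for all levels: the top level is the case \<open>B = 0\<close>.\<close>

definition stationary_density :: "real \<Rightarrow> real \<Rightarrow> real \<Rightarrow> real \<Rightarrow> real \<Rightarrow> real" where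
  "stationary_density \<mu> \<tau> b B s = b * exp (- \<mu> * s + B * min (\<tau> - s) 0)"

context
  fixes \<mu> \<tau> N b c :: real
  assumes \<mu>: "\<mu> > 0" and \<tau>: "\<tau> \<ge> 0" and c: "c \<ge> 0" and b: "b = c + \<mu> * N"
begin

lemma level_solution_rate_continuous:
  assumes "level_solution \<mu> \<tau> b c u"
  shows "continuous_on {0..} (\<lambda>t. c / (LINT s:{\<tau>..}|lborel. u t s))"
proof (cases "c = 0")
  case False
  then have "\<forall>t\<in>{0..}. (LINT s:{\<tau>..}|lborel. u t s) \<noteq> 0"
    using assms by (force simp: level_solution_def)
  moreover have "continuous_in_L1 u" using assms by (simp add: level_solution_def mild_solution_def)
  ultimately show ?thesis
    using \<tau> by (intro continuous_intros continuous_in_L1_integral) auto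
qed simp

lemma level_solution_integrable:
  "level_solution \<mu> \<tau> b c u \<Longrightarrow> t \<ge> 0 \<Longrightarrow> set_integrable lborel {0..} (u t)"
  by (simp add: level_solution_def mild_solution_def continuous_in_L1_def)

lemma level_solution_flux:
  assumes "level_solution \<mu> \<tau> b c u" "t \<ge> 0"
  shows "c / (LINT s:{\<tau>..}|lborel. u t s) * (LINT s:{\<tau>..}|lborel. u t s) = c"
  using assms by (cases "c = 0") (force simp: level_solution_def)+

lemma level_solution_mass:
  assumes u: "level_solution \<mu> \<tau> b c u" and init: "(LINT s:{0..}|lborel. u 0 s) = N" and t: "t \<ge> 0"
  shows "(LINT s:{0..}|lborel. u t s) = N"
proof (rule mass_conserved[where p = "\<lambda>_. 0"])
  show "mild_solution \<mu> \<tau> b (\<lambda>t. c / (LINT s:{\<tau>..}|lborel. u t s)) u"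
    using u by (simp add: level_solution_def)
qed (use level_solution_rate_continuous[OF u] level_solution_flux[OF u] \<mu> \<tau> b init t in auto)

text \<open>Regarding the rate of \<open>u\<close> as given, linear uniqueness identifies
  \<open>u\<close> with a transport solution. Its young mass is independent of that rate and its
  total mass is \<open>N\<close>, so \<open>A\<close>, and with it the rate, is determined by
  \<open>f\<close>. Uniqueness for the nonlinear problem follows.\<close>

lemma level_solution_representation:
  assumes u: "level_solution \<mu> \<tau> b c u"
    and f: "set_integrable lborel {0..} f" "(LINT s:{0..}|lborel. f s) = N"
    and init: "AE s in lborel. s \<ge> 0 \<longrightarrow> u 0 s = f s" and t: "t \<ge> 0"
  shows "(LINT s:{\<tau>..}|lborel. u t s) = N - young_mass \<mu> \<tau> b f t"
    and "AE s in lborel. s \<ge> 0 \<longrightarrow>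
      u t s = transport_solution \<mu> \<tau> b (promotion_rate \<mu> \<tau> N b c f) f t s"
proof -
  define q where "q = (\<lambda>t. c / (LINT s:{\<tau>..}|lborel. u t s))"
  have qc: "continuous_on {0..} q" unfolding q_def by (rule level_solution_rate_continuous[OF u])
  have q0: "q t \<ge> 0" if "t \<ge> 0" for t
    using u c that by (auto simp: q_def level_solution_def less_imp_le)
  have um: "mild_solution \<mu> \<tau> b q u" using u by (simp add: level_solution_def q_def)
  have vm: "mild_solution \<mu> \<tau> b q (transport_solution \<mu> \<tau> b q f)"
    using \<mu> \<tau> qc q0 f by (intro mild_solution_transport_solution) auto
  have init': "AE s in lborel. s \<ge> 0 \<longrightarrow> u 0 s = transport_solution \<mu> \<tau> b q f 0 s"
    using init by eventually_elim (simp add: transport_solution_0)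
  have AE: "AE s in lborel. s \<ge> 0 \<longrightarrow> u t s = transport_solution \<mu> \<tau> b q f t s" if "t \<ge> 0" for t
    by (rule mild_solution_unique[OF um vm qc init' that])
  have ui: "set_integrable lborel {0..} (u t)" if "t \<ge> 0" for t
    using level_solution_integrable[OF u that] .
  have vi: "set_integrable lborel {0..} (transport_solution \<mu> \<tau> b q f t)" if "t \<ge> 0" for t
    using vm that by (simp add: mild_solution_def continuous_in_L1_def)
  have "(LINT s:{0..}|lborel. u 0 s) = N"
    using set_integral_cong_AE_Ici[OF ui[of 0] f(1) init, of "{0..}"] f(2) by simp
  note mass = level_solution_mass[OF u this]
  have A: "(LINT s:{\<tau>..}|lborel. u t s) = N - young_mass \<mu> \<tau> b f t" if t: "t \<ge> 0" for t
    using mass[OF t] set_integral_split_at[OF ui[OF t] \<tau>]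
      set_integral_cong_AE_Ici[OF ui[OF t] vi[OF t] AE[OF t], of "{0..<\<tau>}"]
      young_mass_transport_solution[OF t, of \<tau> \<mu> b q f] by (simp add: subset_iff)
  show "(LINT s:{\<tau>..}|lborel. u t s) = N - young_mass \<mu> \<tau> b f t" by (rule A[OF t])
  have qq: "q t = promotion_rate \<mu> \<tau> N b c f t" if "t \<ge> 0" for t
    using A[OF that] by (simp add: q_def promotion_rate_def)
  \<comment> \<open>\<open>damping\<close> sees the rate only through integrals from 0, so agreement
    for nonnegative times yields equality of the whole functions.\<close>
  have "integral {0..x} q = integral {0..x} (promotion_rate \<mu> \<tau> N b c f)" for x
    using qq by (intro Henstock_Kurzweil_Integration.integral_cong) auto
  then have "transport_solution \<mu> \<tau> b (promotion_rate \<mu> \<tau> N b c f) f = transport_solution \<mu> \<tau> b q f"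
    by (simp add: fun_eq_iff transport_solution_def damping_def)
  then show "AE s in lborel. s \<ge> 0 \<longrightarrow>
      u t s = transport_solution \<mu> \<tau> b (promotion_rate \<mu> \<tau> N b c f) f t s"
    using AE[OF t] by simp
qed

lemma promotion_rate_continuous:
  assumes f: "set_integrable lborel {0..} f"
    and pos: "c = 0 \<or> (\<forall>t\<ge>0. young_mass \<mu> \<tau> b f t < N)"
  shows "continuous_on {0..} (promotion_rate \<mu> \<tau> N b c f)"
proof (cases "c = 0")
  case True
  then show ?thesis by (simp add: promotion_rate_def[abs_def])
next
  case False
  then have "\<forall>t\<in>{0..}. N - young_mass \<mu> \<tau> b f t \<noteq> 0" using pos by force
  then show ?thesis
    unfolding promotion_rate_def[abs_def] using \<mu> \<tau> f
    by (intro continuous_intros continuous_on_young_mass) auto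
qed

lemma promotion_rate_nonneg:
  assumes pos: "c = 0 \<or> (\<forall>t\<ge>0. young_mass \<mu> \<tau> b f t < N)" and "t \<ge> 0"
  shows "promotion_rate \<mu> \<tau> N b c f t \<ge> 0"
  using assms c by (auto simp: promotion_rate_def less_imp_le)

text \<open>The candidate divides \<open>c\<close> by \<open>N - young_mass\<close>, whereas the
  equation divides it by the candidate's own \<open>A\<close>. The two agree once its mass is shown
  to be \<open>N\<close>.\<close>

lemma level_solution_exists:
  assumes f: "set_integrable lborel {0..} f" "(LINT s:{0..}|lborel. f s) = N"
    and pos: "c = 0 \<or> (\<forall>t\<ge>0. young_mass \<mu> \<tau> b f t < N)"
  shows "level_solution \<mu> \<tau> b c (transport_solution \<mu> \<tau> b (promotion_rate \<mu> \<tau> N b c f) f)"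
proof -
  let ?q = "promotion_rate \<mu> \<tau> N b c f"
  let ?u = "transport_solution \<mu> \<tau> b ?q f"
  have qc: "continuous_on {0..} ?q" by (rule promotion_rate_continuous[OF f(1) pos])
  have um: "mild_solution \<mu> \<tau> b ?q ?u"
    using \<mu> \<tau> qc f promotion_rate_nonneg[OF pos] by (intro mild_solution_transport_solution) auto
  have ui: "set_integrable lborel {0..} (?u t)" if "t \<ge> 0" for t
    using um that by (simp add: mild_solution_def continuous_in_L1_def)
  have split: "(LINT s:{0..}|lborel. ?u t s) = young_mass \<mu> \<tau> b f t + (LINT s:{\<tau>..}|lborel. ?u t s)"
    if "t \<ge> 0" for t
    using set_integral_split_at[OF ui[OF that] \<tau>] young_mass_transport_solution[OF that, of \<tau> \<mu> b ?q f] by simp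
  have "(LINT s:{0..}|lborel. ?u 0 s) = (LINT s:{0..}|lborel. f s)"
    by (intro set_lebesgue_integral_cong) (auto simp: transport_solution_0)
  then have init: "(LINT s:{0..}|lborel. ?u 0 s) = N" using f by simp
  have mass: "(LINT s:{0..}|lborel. ?u t s) = N" if t: "t \<ge> 0" for t
  proof (rule mass_conserved[OF um \<tau> _ qc qc b init _ t])
    fix r :: real assume r: "r \<ge> 0"
    \<comment> \<open>Because \<open>A = M - young_mass\<close> with \<open>M\<close> the current
      mass, replacing \<open>N\<close> by \<open>M\<close> in this identity costs exactly
      \<open>?q r * (M - N)\<close>, the defect term allowed by
      \<open>mass_conserved\<close>.\<close>
    have "?q r * (N - young_mass \<mu> \<tau> b f r) = c"
      using pos r by (force simp: promotion_rate_def)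
    then show "?q r * (LINT s:{\<tau>..}|lborel. ?u r s) = c + ?q r * ((LINT s:{0..}|lborel. ?u r s) - N)"
      unfolding split[OF r] by (simp add: algebra_simps)
  qed (use \<mu> in simp)
  have A: "(LINT s:{\<tau>..}|lborel. ?u t s) = N - young_mass \<mu> \<tau> b f t" if "t \<ge> 0" for t
    using mass[OF that] split[OF that] by simp
  show ?thesis
    unfolding level_solution_def
  proof
    show "mild_solution \<mu> \<tau> b (\<lambda>t. c / (LINT s:{\<tau>..}|lborel. ?u t s)) ?u"
      by (rule mild_solution_cong[OF um]) (simp_all add: A promotion_rate_def)
    show "c = 0 \<or> (\<forall>t\<ge>0. 0 < (LINT s:{\<tau>..}|lborel. ?u t s))" using pos A by auto
  qed
qed

section \<open>The stationary state of one level: existence, uniqueness, attraction\<close>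

context
  fixes A B :: real
  assumes A_def: "A = N - b * (1 - exp (- \<mu> * \<tau>)) / \<mu>" and A: "A > 0" and B_def: "B = c / A"
begin

abbreviation (input) "rho_stat \<equiv> stationary_density \<mu> \<tau> b B"

lemma stationary_rate_nonneg: "B \<ge> 0" using c A by (simp add: B_def)

lemma damping_const:
  assumes "t \<ge> 0"
  shows "damping \<mu> \<tau> (\<lambda>_. B) t s = exp (- \<mu> * min t s - B * (t - min t (max 0 (t - s + \<tau>))))"
  using assms by (simp add: damping_def max_def min_def algebra_simps)

text \<open>\<open>rho_stat\<close> is the boundary value \<open>b\<close> times the damping
  accumulated since seniority 0, and damping is multiplicative along a characteristic. For
  \<open>s \<ge> t\<close> the accumulation resumes from seniority \<open>s - t\<close>; for
  \<open>s < t\<close> it starts from \<open>b\<close>.\<close>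

lemma transport_solution_stationary:
  assumes "t \<ge> 0" "s \<ge> 0"
  shows "transport_solution \<mu> \<tau> b (\<lambda>_. B) rho_stat t s = rho_stat s"
proof (cases "s \<ge> t")
  case True
  have "min (\<tau> - (s - t)) 0 - (t - min t (max 0 (t - s + \<tau>))) = min (\<tau> - s) 0"
    using assms True by (auto simp: min_def max_def)
  then have "B * min (\<tau> - s) 0 = B * min (\<tau> - (s - t)) 0 - B * (t - min t (max 0 (t - s + \<tau>)))"
    by (metis right_diff_distrib)
  then show ?thesis
    using True assms by (simp add: transport_solution_def damping_const stationary_density_def
        mult_exp_exp right_diff_distrib min_absorb1)
next
  case False
  have "- (t - min t (max 0 (t - s + \<tau>))) = min (\<tau> - s) 0"
    using assms \<tau> False by (auto simp: min_def max_def)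
  then have "B * min (\<tau> - s) 0 = - (B * (t - min t (max 0 (t - s + \<tau>))))"
    by (metis mult_minus_right)
  then show ?thesis
    using False assms by (simp add: transport_solution_def damping_const stationary_density_def min_absorb2)
qed

lemma stationary_density_integrable: "set_integrable lborel {0..} rho_stat"
proof (rule set_integrable_bound)
  show "set_integrable lborel {0..} (\<lambda>s. b * exp (- \<mu> * s))"
    using set_integrable_exp_Ici[OF \<mu>] by (rule set_integrable_mult_right)
  have [measurable]: "rho_stat \<in> borel_measurable borel"
    unfolding stationary_density_def[abs_def] by measurable
  show "set_borel_measurable lborel {0..} rho_stat" unfolding set_borel_measurable_def by measurable
  show "AE s in lborel. s \<in> {0..} \<longrightarrow> norm (rho_stat s) \<le> norm (b * exp (- \<mu> * s))"
  proof (intro AE_I2 impI)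
    fix s :: real
    have "B * min (\<tau> - s) 0 \<le> 0" using stationary_rate_nonneg by (intro mult_nonneg_nonpos) auto
    then show "norm (rho_stat s) \<le> norm (b * exp (- \<mu> * s))"
      by (auto simp: stationary_density_def abs_mult intro!: mult_left_mono)
  qed
qed

lemma mild_solution_stationary: "mild_solution \<mu> \<tau> b (\<lambda>_. B) (\<lambda>_. rho_stat)"
  using \<mu> \<tau> stationary_rate_nonneg stationary_density_integrable
  by (intro mild_solution_cong[OF mild_solution_transport_solution[of \<mu> \<tau> "\<lambda>_. B" rho_stat b]])
     (auto simp: transport_solution_stationary)

text \<open>Only the young part is integrated explicitly. The mass of seniority at least \<tau>
  comes from the balance \<open>b = \<mu> * M + B * A'\<close>, where \<open>M\<close> is the total
  mass and \<open>A'\<close> the unknown: with \<open>M = N - A + A'\<close> and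
  \<open>B * A = c\<close> this becomes \<open>(\<mu> + B) * A' = (\<mu> + B) * A\<close>.\<close>

lemma stationary_density_mass:
  shows "(LINT s:{\<tau>..}|lborel. rho_stat s) = A" and "(LINT s:{0..}|lborel. rho_stat s) = N"
proof -
  have "(LINT s:{0..<\<tau>}|lborel. rho_stat s) = (LINT s:{0..<\<tau>}|lborel. b * exp (- \<mu> * s))"
    by (intro set_lebesgue_integral_cong) (auto simp: stationary_density_def)
  also have "\<dots> = b * ((1 - exp (- \<mu> * \<tau>)) / \<mu>)"
    unfolding set_integral_mult_right using \<mu> \<tau> by (subst set_integral_exp) auto
  finally have young: "(LINT s:{0..<\<tau>}|lborel. rho_stat s) = N - A" by (simp add: A_def)
  then have M: "(LINT s:{0..}|lborel. rho_stat s) = N - A + (LINT s:{\<tau>..}|lborel. rho_stat s)"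
    using set_integral_split_at[OF stationary_density_integrable \<tau>] by simp
  \<comment> \<open>Over one unit of time the mass at both ends is the same, and the integral of the
    constant loss is the loss itself.\<close>
  have "b = \<mu> * (LINT s:{0..}|lborel. rho_stat s) + B * (LINT s:{\<tau>..}|lborel. rho_stat s)"
    using mild_solution_mass[OF mild_solution_stationary _ \<tau>, of 1] by simp
  then have "b = \<mu> * (N - A) + (\<mu> + B) * (LINT s:{\<tau>..}|lborel. rho_stat s)"
    unfolding M by (simp add: algebra_simps)
  moreover have "B * A = c" using A by (simp add: B_def)
  ultimately have "(\<mu> + B) * (LINT s:{\<tau>..}|lborel. rho_stat s) = (\<mu> + B) * A"
    using b by (simp add: algebra_simps)
  then show "(LINT s:{\<tau>..}|lborel. rho_stat s) = A" using \<mu> stationary_rate_nonneg by auto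
  with M show "(LINT s:{0..}|lborel. rho_stat s) = N" by simp
qed

lemma level_solution_stationary: "level_solution \<mu> \<tau> b c (\<lambda>_. rho_stat)"
  unfolding level_solution_def stationary_density_mass
  using mild_solution_stationary A by (simp add: B_def)

text \<open>The balance forces mass \<open>N\<close>. Evaluating the representation at time \<tau>,
  where the datum no longer enters the young mass, gives \<open>A\<close> as promotable mass and
  hence \<open>B\<close> as rate. For \<open>t > s\<close> the transport formula contains only the
  boundary value, so \<open>r\<close> is determined.\<close>

lemma level_solution_stationary_unique:
  assumes r: "level_solution \<mu> \<tau> b c (\<lambda>_. r)"
  shows "AE s in lborel. s \<ge> 0 \<longrightarrow> r s = rho_stat s"
proof -
  have ri: "set_integrable lborel {0..} r" using level_solution_integrable[OF r, of 0] by simp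
  have rm: "mild_solution \<mu> \<tau> b (\<lambda>_. c / (LINT s:{\<tau>..}|lborel. r s)) (\<lambda>_. r)"
    using r by (simp add: level_solution_def)
  have "b = \<mu> * (LINT s:{0..}|lborel. r s) + c"
    using mild_solution_mass[OF rm _ \<tau>, of 1] level_solution_flux[OF r, of 0] by simp
  then have mass: "(LINT s:{0..}|lborel. r s) = N" using b \<mu> by simp
  have "(LINT s:{\<tau>..}|lborel. r s) = N - young_mass \<mu> \<tau> b r \<tau>"
    using level_solution_representation(1)[OF r ri mass _ \<tau>] by simp
  then have rA: "(LINT s:{\<tau>..}|lborel. r s) = A" using young_mass_late[OF \<mu> \<tau>, of \<tau>] by (simp add: A_def)
  then have rm: "mild_solution \<mu> \<tau> b (\<lambda>_. B) (\<lambda>_. r)" using rm by (simp add: B_def)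
  have vm: "mild_solution \<mu> \<tau> b (\<lambda>_. B) (transport_solution \<mu> \<tau> b (\<lambda>_. B) r)"
    using \<mu> \<tau> stationary_rate_nonneg ri by (intro mild_solution_transport_solution) auto
  \<comment> \<open>The exceptional null set depends on the time; restricting to natural times keeps
    the union of these sets null while still exceeding every \<open>s\<close>.\<close>
  have "AE s in lborel. s \<ge> 0 \<longrightarrow> r s = transport_solution \<mu> \<tau> b (\<lambda>_. B) r (real n) s" for n
    by (rule mild_solution_unique[OF rm vm]) (auto simp: transport_solution_0)
  then have "AE s in lborel. \<forall>n. s \<ge> 0 \<longrightarrow> r s = transport_solution \<mu> \<tau> b (\<lambda>_. B) r (real n) s"
    unfolding AE_all_countable by blast
  then show ?thesis
  proof eventually_elim
    case (elim s)
    show ?case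
    proof
      assume s: "s \<ge> 0"
      obtain n where n: "s < real n" using reals_Archimedean2 by blast
      have "r s = transport_solution \<mu> \<tau> b (\<lambda>_. B) r (real n) s" using elim s by blast
      also have "\<dots> = transport_solution \<mu> \<tau> b (\<lambda>_. B) rho_stat (real n) s"
        using n by (simp add: transport_solution_def)
      also have "\<dots> = rho_stat s" using s by (intro transport_solution_stationary) auto
      finally show "r s = rho_stat s" .
    qed
  qed
qed

text \<open>A worker hired at time \<open>t - s > 0\<close> is exposed to promotion only after
  \<open>t - s + \<tau> > \<tau>\<close>, when the rate has settled at \<open>B\<close>.\<close>

lemma damping_promotion_rate:
  assumes f: "set_integrable lborel {0..} f"
    and pos: "c = 0 \<or> (\<forall>t\<ge>0. young_mass \<mu> \<tau> b f t < N)"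
    and s: "0 \<le> s" "s < t"
  shows "damping \<mu> \<tau> (promotion_rate \<mu> \<tau> N b c f) t s = damping \<mu> \<tau> (\<lambda>_. B) t s"
proof -
  let ?q = "promotion_rate \<mu> \<tau> N b c f"
  define m where "m = min t (max 0 (t - s + \<tau>))"
  \<comment> \<open>Exposure starts at \<open>m\<close>: either it has not begun by time
    \<open>t\<close>, or it lies entirely in the period of constant rate.\<close>
  have m: "0 \<le> m" "m \<le> t" and m': "m = t \<or> m \<ge> \<tau>" using s \<tau> by (auto simp: m_def)
  have "?q integrable_on {0..t}"
    by (intro integrable_continuous_real continuous_on_subset[OF promotion_rate_continuous[OF f pos]]) auto
  then have "integral {0..m} ?q + integral {m..t} ?q = integral {0..t} ?q"
    using m by (intro Henstock_Kurzweil_Integration.integral_combine) auto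
  moreover have "integral {m..t} ?q = integral {m..t} (\<lambda>_. B)"
  proof (cases "m = t")
    case False
    then show ?thesis using m'
      by (intro Henstock_Kurzweil_Integration.integral_cong)
         (auto simp: promotion_rate_def young_mass_late[OF \<mu> \<tau>] B_def A_def)
  qed simp
  ultimately have "integral {0..t} ?q - integral {0..m} ?q = B * (t - m)" using m by (simp add: algebra_simps)
  moreover have "damping \<mu> \<tau> (\<lambda>_. B) t s = exp (- \<mu> * min t s - B * (t - m))"
    using s by (simp only: damping_const m_def)
  ultimately show ?thesis by (simp add: damping_def[of _ _ ?q] m_def)
qed

lemma level_solution_decay:
  assumes u: "level_solution \<mu> \<tau> b c u"
    and f: "set_integrable lborel {0..} f" "(LINT s:{0..}|lborel. f s) = N"
    and init: "AE s in lborel. s \<ge> 0 \<longrightarrow> u 0 s = f s" and t: "t \<ge> 0"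
  shows "(LINT s:{0..}|lborel. \<bar>u t s - rho_stat s\<bar>)
    \<le> exp (- \<mu> * t) * ((LINT s:{0..}|lborel. \<bar>f s\<bar>) + (LINT s:{0..}|lborel. \<bar>rho_stat s\<bar>))"
proof -
  let ?q = "promotion_rate \<mu> \<tau> N b c f"
  \<comment> \<open>Read off from the solution: positivity of its \<open>A\<close> is part of
    \<open>level_solution\<close>, and the representation rewrites it in terms of the young
    mass.\<close>
  have pos: "c = 0 \<or> (\<forall>t\<ge>0. young_mass \<mu> \<tau> b f t < N)"
    using u level_solution_representation(1)[OF u f init] by (auto simp: level_solution_def)
  define g where "g = (\<lambda>s. exp (- \<mu> * t) * (\<bar>f s\<bar> + \<bar>rho_stat s\<bar>))"
  have g: "set_integrable lborel {0..} g"
    unfolding g_def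
    by (intro set_integrable_mult_right set_integral_add set_integrable_abs f stationary_density_integrable)
  have g': "integrable lborel (\<lambda>s. indicator {0..} (s - t) *\<^sub>R g (s - t))" by (rule shifted_initial_integrable[OF g])
  have D: "damping \<mu> \<tau> q t s \<le> exp (- \<mu> * t)"
    if "s \<ge> t" "continuous_on {0..} q" "\<And>t. t \<ge> 0 \<Longrightarrow> q t \<ge> 0" for q s
    using damping_le[of \<mu> \<tau> q t s] that t \<mu> \<tau> f by (simp add: min_absorb1)
  have "AE s in lborel. s \<ge> 0 \<longrightarrow> \<bar>u t s - rho_stat s\<bar> \<le> indicator {0..} (s - t) *\<^sub>R g (s - t)"
    using level_solution_representation(2)[OF u f init t]
  proof eventually_elim
    case (elim s)
    show ?case
    proof
      assume s: "s \<ge> 0"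
      have us: "u t s = transport_solution \<mu> \<tau> b ?q f t s" using elim s by blast
      have rs: "rho_stat s = transport_solution \<mu> \<tau> b (\<lambda>_. B) rho_stat t s"
        using transport_solution_stationary[OF t s] by simp
      show "\<bar>u t s - rho_stat s\<bar> \<le> indicator {0..} (s - t) *\<^sub>R g (s - t)"
      proof (cases "s \<ge> t")
        case True
        have "\<bar>u t s\<bar> \<le> \<bar>f (s - t)\<bar> * exp (- \<mu> * t)"
          unfolding us using True D[OF True promotion_rate_continuous[OF f(1) pos] promotion_rate_nonneg[OF pos]]
          by (auto simp: transport_solution_def abs_mult damping_def intro!: mult_left_mono)
        moreover have "\<bar>rho_stat s\<bar> \<le> \<bar>rho_stat (s - t)\<bar> * exp (- \<mu> * t)"
          unfolding rs using True D[OF True, of "\<lambda>_. B"] stationary_rate_nonneg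
          by (auto simp: transport_solution_def abs_mult damping_def intro!: mult_left_mono)
        ultimately show ?thesis using True by (simp add: g_def algebra_simps)
      next
        case False
        then have "u t s = rho_stat s"
          unfolding us rs using damping_promotion_rate[OF f(1) pos s, of t] by (simp add: transport_solution_def)
        then show ?thesis using False by simp
      qed
    qed
  qed
  then have "AE s in lborel. indicator {0..} s *\<^sub>R \<bar>u t s - rho_stat s\<bar> \<le> indicator {0..} (s - t) *\<^sub>R g (s - t)"
    by eventually_elim (auto simp: indicator_def g_def)
  moreover have "integrable lborel (\<lambda>s. indicator {0..} s *\<^sub>R \<bar>u t s - rho_stat s\<bar>)"
    using set_integrable_abs[OF set_integral_diff(1)[OF level_solution_integrable[OF u t] stationary_density_integrable]]
    by (simp add: set_integrable_def)
  ultimately have "(LINT s:{0..}|lborel. \<bar>u t s - rho_stat s\<bar>) \<le> (LINT s|lborel. indicator {0..} (s - t) *\<^sub>R g (s - t))"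
    unfolding set_lebesgue_integral_def using g' by (intro integral_mono_AE) auto
  also have "\<dots> = (LINT s:{0..}|lborel. g s)"
    using lborel_integral_real_affine[of 1 "\<lambda>s. indicator {0..} s *\<^sub>R g s" "-t"]
    by (simp add: set_lebesgue_integral_def)
  also have "\<dots> = exp (- \<mu> * t) * (LINT s:{0..}|lborel. \<bar>f s\<bar> + \<bar>rho_stat s\<bar>)" by (simp add: g_def)
  also have "(LINT s:{0..}|lborel. \<bar>f s\<bar> + \<bar>rho_stat s\<bar>) = (LINT s:{0..}|lborel. \<bar>f s\<bar>) + (LINT s:{0..}|lborel. \<bar>rho_stat s\<bar>)"
    by (intro set_integral_add set_integrable_abs f stationary_density_integrable)
  finally show ?thesis .
qed

text \<open>
  The constant depends on the initial datum \<open>f\<close>; when \<open>f\<close> is stationary, so is the solution, by uniqueness.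
\<close>

lemma level_solution_stability:
  assumes f: "set_integrable lborel {0..} f" "(LINT s:{0..}|lborel. f s) = N"
  obtains C where "C \<ge> 0"
    "\<And>u t. level_solution \<mu> \<tau> b c u \<Longrightarrow> AE s in lborel. s \<ge> 0 \<longrightarrow> u 0 s = f s \<Longrightarrow> t \<ge> 0 \<Longrightarrow>
      (LINT s:{0..}|lborel. \<bar>u t s - rho_stat s\<bar>) \<le> C * exp (- \<mu> * t) * (LINT s:{0..}|lborel. \<bar>u 0 s - rho_stat s\<bar>)"
proof -
  define D where "D = (LINT s:{0..}|lborel. \<bar>f s - rho_stat s\<bar>)"
  \<comment> \<open>Chosen so that \<open>C * D\<close> is the bound of
    \<open>level_solution_decay\<close> when \<open>D\<close> is nonzero. For \<open>D = 0\<close>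
    division by zero gives \<open>C = 0\<close>, and the left side has to vanish.\<close>
  define C where "C = ((LINT s:{0..}|lborel. \<bar>f s\<bar>) + (LINT s:{0..}|lborel. \<bar>rho_stat s\<bar>)) / D"
  have nonneg: "(LINT s:{0..}|lborel. \<bar>h s\<bar>) \<ge> 0" for h :: "real \<Rightarrow> real" by (simp add: set_lebesgue_integral_def)
  have fr: "set_integrable lborel {0..} (\<lambda>s. \<bar>f s - rho_stat s\<bar>)"
    by (intro set_integrable_abs set_integral_diff f stationary_density_integrable)
  show thesis
  proof (rule that[of C])
    show "C \<ge> 0" using nonneg by (auto simp: C_def D_def)
    fix u t assume u: "level_solution \<mu> \<tau> b c u" and init: "AE s in lborel. s \<ge> 0 \<longrightarrow> u 0 s = f s" and t: "t \<ge> (0::real)"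
    have "(LINT s:{0..}|lborel. \<bar>u 0 s - rho_stat s\<bar>) = D"
      unfolding D_def
    proof (rule set_integral_cong_AE_Ici[OF _ fr])
      show "set_integrable lborel {0..} (\<lambda>s. \<bar>u 0 s - rho_stat s\<bar>)"
        by (intro set_integrable_abs set_integral_diff level_solution_integrable[OF u] stationary_density_integrable) simp
      show "AE s in lborel. s \<ge> 0 \<longrightarrow> \<bar>u 0 s - rho_stat s\<bar> = \<bar>f s - rho_stat s\<bar>" using init by eventually_elim simp
    qed auto
    moreover have "(LINT s:{0..}|lborel. \<bar>u t s - rho_stat s\<bar>) \<le> C * exp (- \<mu> * t) * D"
    proof (cases "D = 0")
      case False
      then show ?thesis using level_solution_decay[OF u f init t] by (simp add: C_def mult.commute)
    next
      case True
      then have "AE s in lborel. indicator {0..} s *\<^sub>R \<bar>f s - rho_stat s\<bar> = 0"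
        using fr unfolding D_def set_lebesgue_integral_def set_integrable_def
        by (subst (asm) integral_nonneg_eq_0_iff_AE) auto
      then have "AE s in lborel. s \<ge> 0 \<longrightarrow> u 0 s = rho_stat s"
        using init by eventually_elim auto
      \<comment> \<open>Both \<open>u\<close> and the constant curve \<open>rho_stat\<close> are
        represented by the same transport formula with datum \<open>rho_stat\<close>, so they
        coincide.\<close>
      note ur = level_solution_representation(2)[OF u stationary_density_integrable stationary_density_mass(2) this t]
      have "AE s in lborel. s \<ge> 0 \<longrightarrow>
          rho_stat s = transport_solution \<mu> \<tau> b (promotion_rate \<mu> \<tau> N b c rho_stat) rho_stat t s"
        by (rule level_solution_representation(2)[OF level_solution_stationary stationary_density_integrable
              stationary_density_mass(2) _ t]) simp
      with ur have "AE s in lborel. indicator {0..} s *\<^sub>R \<bar>u t s - rho_stat s\<bar> = 0"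
        by eventually_elim auto
      then have "(LINT s:{0..}|lborel. \<bar>u t s - rho_stat s\<bar>) = 0"
        unfolding set_lebesgue_integral_def by (rule integral_eq_zero_AE)
      then show ?thesis using True by simp
    qed
    ultimately show "(LINT s:{0..}|lborel. \<bar>u t s - rho_stat s\<bar>)
      \<le> C * exp (- \<mu> * t) * (LINT s:{0..}|lborel. \<bar>u 0 s - rho_stat s\<bar>)" by simp
  qed
qed

end

end

subsection \<open>The hierarchy\<close>

text \<open>At the top level \<open>Cno L N \<mu> (L + 1)\<close> is an empty sum, so the promotion
  term is 0 and the alternative \<open>c = 0\<close> of \<open>level_solution\<close> holds. The
  hypothesis excludes that alternative below the top, where positivity of the promotable mass is
  required.\<close>

lemma is_solution_iff_level_solution:
  assumes "\<And>j. j \<in> {1..<L} \<Longrightarrow> Cno L N \<mu> (j + 1) \<noteq> 0"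
  shows "is_solution L N \<mu> \<tau> \<rho> \<longleftrightarrow>
    (\<forall>j\<in>{1..L}. level_solution (\<mu> j) (\<tau> j) (Cno L N \<mu> j) (Cno L N \<mu> (j + 1)) (\<rho> j))"
proof -
  have loss: "loss_rate L N \<mu> \<tau> j f s = \<mu> j + Cno L N \<mu> (j + 1) / (LINT s:{\<tau> j..}|lborel. f s) * indicator {\<tau> j..} s"
    if "j \<in> {1..L}" for j f s
    using that by (auto simp: loss_rate_def promotable_def Cno_def)
  have pos: "(j < L \<longrightarrow> (\<forall>t\<ge>0. promotable \<tau> j (\<rho> j t) > 0)) \<longleftrightarrow>
      Cno L N \<mu> (j + 1) = 0 \<or> (\<forall>t\<ge>0. (LINT s:{\<tau> j..}|lborel. \<rho> j t s) > 0)" if "j \<in> {1..L}" for j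
    using assms[of j] that by (cases "j < L") (auto simp: promotable_def Cno_def)
  show ?thesis
    unfolding is_solution_def level_solution_def mild_solution_def
    by (intro ball_cong refl) (simp only: loss pos conj_ac)
qed

theorem proposition2p3:
  fixes L :: nat and N \<mu> \<tau> :: "nat \<Rightarrow> real"
  assumes "L \<ge> 2"
    and "\<And>j. j \<in> {1..L} \<Longrightarrow> N j > 0"
    and "\<And>j. j \<in> {1..L} \<Longrightarrow> \<mu> j > 0"
    and "\<And>j. j \<in> {1..L} \<Longrightarrow> \<tau> j \<ge> 0"
    and "\<And>j. j \<in> {1..<L} \<Longrightarrow> A_bar L N \<mu> \<tau> j > 0"
  shows "stationary_state L N \<mu> \<tau> (rho_bar L N \<mu> \<tau>) \<and>
    (\<forall>r. stationary_state L N \<mu> \<tau> r \<longrightarrow>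
       (\<forall>j\<in>{1..L}. AE s in lborel. s \<ge> 0 \<longrightarrow> r j s = rho_bar L N \<mu> \<tau> j s)) \<and>
    (\<forall>\<rho>0 :: nat \<Rightarrow> real \<Rightarrow> real.
       (\<forall>j\<in>{1..L}. set_integrable lborel {0..} (\<rho>0 j) \<and>
          (AE s in lborel. s \<ge> 0 \<longrightarrow> \<rho>0 j s > 0) \<and>
          (LINT s:{0..}|lborel. \<rho>0 j s) = N j) \<and>
       (\<forall>j\<in>{1..<L}. \<forall>t\<in>{0..\<tau> j}.
          exp (- t * \<mu> j) * (LINT s:{t..\<tau> j}|lborel. \<rho>0 j (s - t))
            + 1 / \<mu> j * (1 - exp (- \<mu> j * t)) * (\<Sum>l=j..L. \<mu> l * N l) < N j) \<longrightarrow>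
       (\<exists>\<rho>. solves_ivp L N \<mu> \<tau> \<rho>0 \<rho>) \<and>
       (\<forall>\<rho> \<rho>'. solves_ivp L N \<mu> \<tau> \<rho>0 \<rho> \<and> solves_ivp L N \<mu> \<tau> \<rho>0 \<rho>' \<longrightarrow>
          (\<forall>j\<in>{1..L}. \<forall>t\<ge>0. AE s in lborel. s \<ge> 0 \<longrightarrow> \<rho> j t s = \<rho>' j t s)) \<and>
       (\<exists>C::real. \<forall>\<rho>. solves_ivp L N \<mu> \<tau> \<rho>0 \<rho> \<longrightarrow>
          (\<forall>j\<in>{1..L}. \<forall>t \<ge> Max (\<tau> ` {1..L}).
             (LINT s:{0..}|lborel. \<bar>\<rho> j t s - rho_bar L N \<mu> \<tau> j s\<bar>)
               \<le> C * exp (- \<mu> j * t) *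
                   (LINT s:{0..}|lborel. \<bar>\<rho> j 0 s - rho_bar L N \<mu> \<tau> j s\<bar>))))"
proof -
  define c b where "c = (\<lambda>j. Cno L N \<mu> (j + 1))" and "b = Cno L N \<mu>"
  have nonneg: "\<mu> l * N l \<ge> 0" if "l \<in> {1..L}" for l using assms(2,3)[OF that] by simp
  have c0: "c j \<ge> 0" if "j \<in> {1..L}" for j
    unfolding c_def Cno_def by (intro sum_nonneg nonneg) auto
  have cpos: "c j > 0" if "j \<in> {1..<L}" for j
    unfolding c_def Cno_def using assms(2,3) that by (intro sum_pos) auto
  have cL: "c L = 0" by (simp add: c_def Cno_def)
  have b: "b j = c j + \<mu> j * N j" if "j \<in> {1..L}" for j
    using that by (simp add: b_def c_def Cno_def sum.atLeast_Suc_atMost)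
  have sol: "is_solution L N \<mu> \<tau> \<rho> \<longleftrightarrow> (\<forall>j\<in>{1..L}. level_solution (\<mu> j) (\<tau> j) (b j) (c j) (\<rho> j))" for \<rho>
    unfolding b_def c_def
    by (rule is_solution_iff_level_solution) (use cpos in \<open>force simp: c_def\<close>)
  let ?A = "A_bar L N \<mu> \<tau>" and ?B = "B_bar L N \<mu> \<tau>"
  have A_eq: "?A j = N j - b j * (1 - exp (- \<mu> j * \<tau> j)) / \<mu> j" if "j \<in> {1..L}" for j
    using assms(3)[OF that] by (simp add: A_bar_def b[OF that] c_def field_simps)
  \<comment> \<open>At the top level \<open>A_bar\<close> reduces to
    \<open>N L * exp (- \<mu> L * \<tau> L)\<close>, so the stationary lemmas apply there
    too.\<close>
  have A_pos: "?A j > 0" if "j \<in> {1..L}" for j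
  proof (cases "j < L")
    case False
    then have "j = L" using that by simp
    then show ?thesis using assms(2,3)[OF that] cL by (simp add: A_bar_def c_def)
  qed (use assms(5) that in auto)
  have B_eq: "?B j = c j / ?A j" for j by (simp add: B_bar_def c_def Cno_def)
  have rho_bar: "rho_bar L N \<mu> \<tau> j = stationary_density (\<mu> j) (\<tau> j) (b j) (?B j)" if "j \<in> {1..L}" for j
  proof (cases "j < L")
    case True
    then show ?thesis by (simp add: fun_eq_iff rho_bar_def stationary_density_def b_def Cno_def mult.commute)
  next
    case False
    then have "j = L" using that by simp
    moreover have "?B L = 0" using B_eq[of L] cL by simp
    ultimately show ?thesis by (simp add: fun_eq_iff rho_bar_def stationary_density_def b_def Cno_def)
  qed
  have "stationary_state L N \<mu> \<tau> (rho_bar L N \<mu> \<tau>)"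
    unfolding stationary_state_def sol
  proof (intro conjI ballI AE_I2 impI)
    fix j assume j: "j \<in> {1..L}"
    show "level_solution (\<mu> j) (\<tau> j) (b j) (c j) (\<lambda>_. rho_bar L N \<mu> \<tau> j)"
      unfolding rho_bar[OF j] by (rule level_solution_stationary[OF assms(3,4)[OF j] c0[OF j] b[OF j] A_eq[OF j] A_pos[OF j] B_eq])
    show "rho_bar L N \<mu> \<tau> j s \<ge> 0" for s
      unfolding rho_bar[OF j] stationary_density_def using b[OF j] c0[OF j] nonneg[OF j] by simp
  qed
  moreover have "AE s in lborel. s \<ge> 0 \<longrightarrow> r j s = rho_bar L N \<mu> \<tau> j s"
    if r: "stationary_state L N \<mu> \<tau> r" and j: "j \<in> {1..L}" for r j
  proof -
    have "level_solution (\<mu> j) (\<tau> j) (b j) (c j) (\<lambda>_. r j)"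
      using r j unfolding stationary_state_def sol by blast
    then show ?thesis
      unfolding rho_bar[OF j]
      by (rule level_solution_stationary_unique[OF assms(3,4)[OF j] c0[OF j] b[OF j] A_eq[OF j] A_pos[OF j] B_eq])
  qed
  moreover have "(\<exists>\<rho>. solves_ivp L N \<mu> \<tau> \<rho>0 \<rho>) \<and>
       (\<forall>\<rho> \<rho>'. solves_ivp L N \<mu> \<tau> \<rho>0 \<rho> \<and> solves_ivp L N \<mu> \<tau> \<rho>0 \<rho>' \<longrightarrow>
          (\<forall>j\<in>{1..L}. \<forall>t\<ge>0. AE s in lborel. s \<ge> 0 \<longrightarrow> \<rho> j t s = \<rho>' j t s)) \<and>
       (\<exists>C::real. \<forall>\<rho>. solves_ivp L N \<mu> \<tau> \<rho>0 \<rho> \<longrightarrow>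
          (\<forall>j\<in>{1..L}. \<forall>t \<ge> Max (\<tau> ` {1..L}).
             (LINT s:{0..}|lborel. \<bar>\<rho> j t s - rho_bar L N \<mu> \<tau> j s\<bar>)
               \<le> C * exp (- \<mu> j * t) *
                   (LINT s:{0..}|lborel. \<bar>\<rho> j 0 s - rho_bar L N \<mu> \<tau> j s\<bar>)))"
    if init: "\<forall>j\<in>{1..L}. set_integrable lborel {0..} (\<rho>0 j) \<and>
          (AE s in lborel. s \<ge> 0 \<longrightarrow> \<rho>0 j s > 0) \<and>
          (LINT s:{0..}|lborel. \<rho>0 j s) = N j"
      and small: "\<forall>j\<in>{1..<L}. \<forall>t\<in>{0..\<tau> j}.
          exp (- t * \<mu> j) * (LINT s:{t..\<tau> j}|lborel. \<rho>0 j (s - t))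
            + 1 / \<mu> j * (1 - exp (- \<mu> j * t)) * (\<Sum>l=j..L. \<mu> l * N l) < N j" for \<rho>0
  proof -
    have f: "set_integrable lborel {0..} (\<rho>0 j)" "(LINT s:{0..}|lborel. \<rho>0 j s) = N j" if "j \<in> {1..L}" for j
      using init that by auto
    have young: "c j = 0 \<or> (\<forall>t\<ge>0. young_mass (\<mu> j) (\<tau> j) (b j) (\<rho>0 j) t < N j)" if j: "j \<in> {1..L}" for j
    proof (cases "j < L")
      case True
      have "young_mass (\<mu> j) (\<tau> j) (b j) (\<rho>0 j) t < N j" if t: "t \<ge> 0" for t
      proof (cases "t \<le> \<tau> j")
        case True
        have "j \<in> {1..<L}" "t \<in> {0..\<tau> j}" using j t True \<open>j < L\<close> by auto
        from small[rule_format, OF this] show ?thesis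
          using young_mass_early[OF assms(3)[OF j] t True f(1)[OF j], of "b j"] by (simp add: b_def Cno_def)
      next
        case False
        then show ?thesis
          using young_mass_late[OF assms(3,4)[OF j], of t "b j" "\<rho>0 j"] A_eq[OF j] A_pos[OF j] by simp
      qed
      then show ?thesis by blast
    next
      case False
      then have "j = L" using j by simp
      then show ?thesis using cL by simp
    qed
    let ?\<rho> = "\<lambda>j. transport_solution (\<mu> j) (\<tau> j) (b j) (promotion_rate (\<mu> j) (\<tau> j) (N j) (b j) (c j) (\<rho>0 j)) (\<rho>0 j)"
    have "solves_ivp L N \<mu> \<tau> \<rho>0 ?\<rho>"
      unfolding solves_ivp_def sol
    proof (intro conjI ballI AE_I2 impI)
      fix j assume j: "j \<in> {1..L}"
      show "level_solution (\<mu> j) (\<tau> j) (b j) (c j) (?\<rho> j)"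
        using level_solution_exists[OF assms(3,4)[OF j] c0[OF j] b[OF j] f[OF j] young[OF j]] .
    qed (simp add: transport_solution_0)
    moreover have rep: "AE s in lborel. s \<ge> 0 \<longrightarrow> \<rho> j t s = ?\<rho> j t s"
      if "solves_ivp L N \<mu> \<tau> \<rho>0 \<rho>" "j \<in> {1..L}" "t \<ge> 0" for \<rho> j t
    proof (rule level_solution_representation(2)[OF assms(3,4)[OF that(2)] c0[OF that(2)] b[OF that(2)] _ f[OF that(2)] _ that(3)])
    qed (use that in \<open>auto simp: solves_ivp_def sol\<close>)
    moreover have "\<exists>C::real. \<forall>\<rho>. solves_ivp L N \<mu> \<tau> \<rho>0 \<rho> \<longrightarrow>
          (\<forall>j\<in>{1..L}. \<forall>t \<ge> Max (\<tau> ` {1..L}).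
             (LINT s:{0..}|lborel. \<bar>\<rho> j t s - rho_bar L N \<mu> \<tau> j s\<bar>)
               \<le> C * exp (- \<mu> j * t) *
                   (LINT s:{0..}|lborel. \<bar>\<rho> j 0 s - rho_bar L N \<mu> \<tau> j s\<bar>))"
    proof -
      let ?E = "\<lambda>u j t. LINT s:{0..}|lborel. \<bar>u t s - rho_bar L N \<mu> \<tau> j s\<bar>"
      \<comment> \<open>Nonnegativity is recorded together with the estimate so that the sum of the
        constants of all levels dominates each of them and serves as the common constant.\<close>
      define good where "good = (\<lambda>j C. C \<ge> 0 \<and> (\<forall>u t. level_solution (\<mu> j) (\<tau> j) (b j) (c j) u \<longrightarrow>
          (AE s in lborel. s \<ge> 0 \<longrightarrow> u 0 s = \<rho>0 j s) \<longrightarrow> t \<ge> 0 \<longrightarrow> ?E u j t \<le> C * exp (- \<mu> j * t) * ?E u j 0))"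
      have "\<exists>C. good j C" if j: "j \<in> {1..L}" for j
        unfolding rho_bar[OF j] good_def
        by (rule level_solution_stability[OF assms(3,4)[OF j] c0[OF j] b[OF j] A_eq[OF j] A_pos[OF j] B_eq f[OF j]]) blast
      then obtain C where C: "\<And>j. j \<in> {1..L} \<Longrightarrow> good j (C j)" by metis
      have "?E (\<rho> j) j t \<le> (\<Sum>i\<in>{1..L}. C i) * exp (- \<mu> j * t) * ?E (\<rho> j) j 0"
        if \<rho>: "solves_ivp L N \<mu> \<tau> \<rho>0 \<rho>" and j: "j \<in> {1..L}" and t: "t \<ge> Max (\<tau> ` {1..L})" for \<rho> j t
      proof -
        have "\<tau> j \<le> Max (\<tau> ` {1..L})" using j by (intro Max_ge) auto
        then have "t \<ge> 0" using assms(4)[OF j] t by simp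
        then have "?E (\<rho> j) j t \<le> C j * exp (- \<mu> j * t) * ?E (\<rho> j) j 0"
          using C[OF j] \<rho> j unfolding solves_ivp_def sol good_def by blast
        also have "\<dots> \<le> (\<Sum>i\<in>{1..L}. C i) * exp (- \<mu> j * t) * ?E (\<rho> j) j 0"
          using C j unfolding good_def by (intro mult_right_mono member_le_sum) (auto simp: set_lebesgue_integral_def)
        finally show ?thesis .
      qed
      then show ?thesis by blast
    qed
    moreover have "AE s in lborel. s \<ge> 0 \<longrightarrow> \<rho> j t s = \<rho>' j t s"
      if "solves_ivp L N \<mu> \<tau> \<rho>0 \<rho>" "solves_ivp L N \<mu> \<tau> \<rho>0 \<rho>'" "j \<in> {1..L}" "t \<ge> 0" for \<rho> \<rho>' j t
      using rep[OF that(1,3,4)] rep[OF that(2,3,4)] by eventually_elim simp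
    ultimately show ?thesis by blast
  qed
  ultimately show ?thesis by blast
qed

end
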